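(* Let $q\ge 1$ and $n\ge q+3$ be integers. Then $\mathrm{sat}(n, K_1\vee(K_{2}\cup qK_1))=n-1$. Furthermore: if $q=1$, then $\mathrm{SAT}(n, K_1\vee(K_2\cup qK_1))$ consists exactly, up to isomorphism, of $S_n$ and the graphs $aK_3\cup S_{n-3a}$, where $a$ ranges over the positive integers with $n>3a$ and $n-3a\neq 3$; if $q\ge 2$, then $\mathrm{SAT}(n, K_1\vee(K_2\cup qK_1))=\{S_n\}$ up to isomorphism.
   Context: All graphs are finite and simple. For graphs $F$ and $G$, $G$ is $F$-saturated if $G$ contains no copy of $F$ as a (not necessarily induced) subgraph, but for every edge $e$ of the complement $\overline{G}$, the graph $G+e$ obtained by adding $e$ to $G$ contains a copy of $F$. The saturation number $\mathrm{sat}(n,F)$ is the minimum number of edges in an $F$-saturated graph on $n$ vertices, and $\mathrm{SAT}(n,F)$ is the set (up to isomorphism) of $F$-saturated graphs on $n$ vertices with exactly $\mathrm{sat}(n,F)$ edges. $K_m$ is the complete graph on $m$ vertices, $S_m$ is the star on $m$ vertices (one center adjacent to $m-1$ leaves; $S_1=K_1$, $S_2=K_2$), $\cup$ denotes vertex-disjoint union, $mG$ denotes the disjoint union of $m$ copies of $G$, and $G_1\vee G_2$ is the join, obtained from the disjoint union $G_1\cup G_2$ by adding all edges between $V(G_1)$ and $V(G_2)$. *)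

theory Defs
  imports Main
begin

text \<open>Edges are two-element vertex sets; the record itself carries no
  well-formedness, which is the predicate \<open>simple_graph\<close>.\<close>

record 'a graph =
  verts :: "'a set"
  edges :: "'a set set"

definition simple_graph :: "'a graph \<Rightarrow> bool" where
  "simple_graph G \<longleftrightarrow>
     finite (verts G) \<and> (\<forall>e \<in> edges G. e \<subseteq> verts G \<and> card e = 2)"

definition complement :: "'a graph \<Rightarrow> 'a graph" where
  "complement G =
     \<lparr>verts = verts G, edges = {e. e \<subseteq> verts G \<and> card e = 2 \<and> e \<notin> edges G}\<rparr>"

definition add_edge :: "'a graph \<Rightarrow> 'a set \<Rightarrow> 'a graph" where
  "add_edge G e = \<lparr>verts = verts G, edges = insert e (edges G)\<rparr>"

definition subgraph :: "'a graph \<Rightarrow> 'a graph \<Rightarrow> bool" where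
  "subgraph H G \<longleftrightarrow> simple_graph H \<and> verts H \<subseteq> verts G \<and> edges H \<subseteq> edges G"

definition graph_iso :: "'a graph \<Rightarrow> 'b graph \<Rightarrow> bool" (infix "\<cong>\<^sub>G" 50) where
  "G \<cong>\<^sub>G H \<longleftrightarrow>
     (\<exists>f. bij_betw f (verts G) (verts H) \<and> edges H = (\<lambda>e. f ` e) ` edges G)"

definition contains_copy :: "'a graph \<Rightarrow> 'b graph \<Rightarrow> bool" where
  "contains_copy G F \<longleftrightarrow> (\<exists>H. subgraph H G \<and> F \<cong>\<^sub>G H)"

definition saturated :: "'b graph \<Rightarrow> 'a graph \<Rightarrow> bool" where
  "saturated F G \<longleftrightarrow>
     \<not> contains_copy G F \<and>
     (\<forall>e \<in> edges (complement G). contains_copy (add_edge G e) F)"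

text \<open>The minimum ranges over graphs with vertices in \<^typ>\<open>nat\<close>, which represent all
  finite graphs up to isomorphism. If no \<open>F\<close>-saturated graph on \<open>n\<close> vertices existed,
  the value would be unspecified.\<close>

definition sat :: "nat \<Rightarrow> 'b graph \<Rightarrow> nat" where
  "sat n F = (LEAST m. \<exists>G :: nat graph.
     simple_graph G \<and> card (verts G) = n \<and> saturated F G \<and> card (edges G) = m)"

text \<open>All labelled extremal graphs with vertices in \<^typ>\<open>'a\<close>; this set is closed under
  isomorphism within \<^typ>\<open>'a graph\<close>.\<close>

definition SAT :: "nat \<Rightarrow> 'b graph \<Rightarrow> 'a graph set" where
  "SAT n F = {G. simple_graph G \<and> card (verts G) = n \<and> saturated F G \<and>
                 card (edges G) = sat n F}"

definition complete_graph :: "nat \<Rightarrow> nat graph" where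
  "complete_graph m = \<lparr>verts = {..<m}, edges = {e. e \<subseteq> {..<m} \<and> card e = 2}\<rparr>"

text \<open>The star on \<open>m\<close> vertices in total, with centre 0.\<close>

definition star :: "nat \<Rightarrow> nat graph" where
  "star m = \<lparr>verts = {..<m}, edges = {{0, i} |i. 0 < i \<and> i < m}\<rparr>"

definition disjoint_union :: "'a graph \<Rightarrow> 'b graph \<Rightarrow> ('a + 'b) graph"
    (infixl "\<union>\<^sub>G" 65) where
  "G \<union>\<^sub>G H = \<lparr>verts = verts G <+> verts H,
             edges = (\<lambda>e. Inl ` e) ` edges G \<union> (\<lambda>e. Inr ` e) ` edges H\<rparr>"

definition copies :: "nat \<Rightarrow> 'a graph \<Rightarrow> (nat \<times> 'a) graph" where
  "copies m G = \<lparr>verts = {..<m} \<times> verts G,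
                 edges = {Pair i ` e |i e. i < m \<and> e \<in> edges G}\<rparr>"

definition join :: "'a graph \<Rightarrow> 'b graph \<Rightarrow> ('a + 'b) graph" (infixl "\<or>\<^sub>G" 65) where
  "G \<or>\<^sub>G H = \<lparr>verts = verts (G \<union>\<^sub>G H),
             edges = edges (G \<union>\<^sub>G H) \<union> {{Inl u, Inr v} |u v. u \<in> verts G \<and> v \<in> verts H}\<rparr>"

end

theory Submission
  imports Defs
begin

text \<open>A graph contains \<open>K\<^sub>1 \<or> (K\<^sub>2 \<union> qK\<^sub>1)\<close> iff some vertex of degree at least \<open>q + 2\<close> lies on a
  triangle. Joining two components of a saturated graph \<open>G\<close> by an edge creates no triangle, so one
  of the ends already lies on a triangle and has degree \<open>q + 1\<close>. If a vertex \<open>u\<close> fails this, then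
  all vertices outside its component have degree \<open>q + 1 \<ge> 2\<close>, and with a spanning tree of the
  component of \<open>u\<close> this gives at least \<open>n - 1\<close> edges; if no vertex fails, there are at least \<open>n\<close>.
  In case of equality the component of \<open>u\<close> is a tree in which any two non-adjacent vertices have a
  common neighbour, hence a star, and the remaining vertices, if any, force \<open>q = 1\<close> and form
  disjoint triangles. A star on three vertices is excluded since closing it up gives a triangle whose
  vertices have degree 2.\<close>

section \<open>Copies of the forbidden graph\<close>

lemma simple_graph_complete: "simple_graph (complete_graph m)"
  by (auto simp: simple_graph_def complete_graph_def)

lemma simple_graph_disjoint_union:
  assumes "simple_graph G" "simple_graph H"
  shows "simple_graph (G \<union>\<^sub>G H)"
  using assms
  by (fastforce simp: simple_graph_def disjoint_union_def card_image)

lemma simple_graph_copies: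
  assumes "simple_graph G"
  shows "simple_graph (copies m G)"
  using assms
  by (fastforce simp: simple_graph_def copies_def card_image inj_on_def)

lemma simple_graph_join:
  assumes "simple_graph G" "simple_graph H"
  shows "simple_graph (G \<or>\<^sub>G H)"
  unfolding simple_graph_def
proof (intro conjI ballI)
  note U = simple_graph_disjoint_union[OF assms]
  have V: "verts (G \<or>\<^sub>G H) = verts (G \<union>\<^sub>G H)" by (simp add: join_def)
  show "finite (verts (G \<or>\<^sub>G H))" using U V by (simp add: simple_graph_def)
  fix e assume "e \<in> edges (G \<or>\<^sub>G H)"
  then consider "e \<in> edges (G \<union>\<^sub>G H)"
    | u v where "e = {Inl u, Inr v}" "u \<in> verts G" "v \<in> verts H"
    by (auto simp: join_def)
  then have "e \<subseteq> verts (G \<union>\<^sub>G H) \<and> card e = 2"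
    using U by cases (auto simp: simple_graph_def disjoint_union_def)
  then show "e \<subseteq> verts (G \<or>\<^sub>G H)" "card e = 2" using V by auto
qed

text \<open>The image of \<open>F\<close> under an injection that preserves edges is a simple graph
  and serves as the copy; conversely an isomorphism onto a copy is such an injection.\<close>

lemma contains_copy_iff_embedding:
  assumes F: "simple_graph F" and G: "simple_graph G"
  shows "contains_copy G F \<longleftrightarrow>
    (\<exists>f. inj_on f (verts F) \<and> f ` verts F \<subseteq> verts G \<and> (\<forall>e\<in>edges F. f ` e \<in> edges G))"
    (is "?L \<longleftrightarrow> ?R")
proof
  assume ?L
  then show ?R
    by (force simp: contains_copy_def subgraph_def graph_iso_def bij_betw_def)
next
  assume ?R
  then obtain f where f: "inj_on f (verts F)" "f ` verts F \<subseteq> verts G"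
    "\<forall>e\<in>edges F. f ` e \<in> edges G" by blast
  let ?H = "\<lparr>verts = f ` verts F, edges = (\<lambda>e. f ` e) ` edges F\<rparr>"
  have "simple_graph ?H"
    using F G f unfolding simple_graph_def by (simp add: image_mono)
  then have "subgraph ?H G"
    using f by (auto simp: subgraph_def)
  moreover have "F \<cong>\<^sub>G ?H"
    using f by (auto simp: graph_iso_def bij_betw_def)
  ultimately show ?L by (auto simp: contains_copy_def)
qed

text \<open>In the nested sum type the apex is \<open>Inl 0\<close>, the ends of the edge of K_2 are
  \<open>Inr (Inl 0)\<close> and \<open>Inr (Inl 1)\<close>, and the vertices of qK_1 are
  \<open>Inr (Inr (i, 0))\<close> with \<open>i < q\<close>.\<close>

definition forbidden :: "nat \<Rightarrow> (nat + (nat + nat \<times> nat)) graph" where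
  "forbidden q = complete_graph 1 \<or>\<^sub>G (complete_graph 2 \<union>\<^sub>G copies q (complete_graph 1))"

lemma card_two_subset_pair: "e \<subseteq> {a, b} \<Longrightarrow> card e = 2 \<Longrightarrow> e = {a, b}"
  by (auto simp: card_2_iff)

lemma simple_graph_forbidden: "simple_graph (forbidden q)"
  unfolding forbidden_def
  by (intro simple_graph_join simple_graph_disjoint_union simple_graph_copies simple_graph_complete)

lemma verts_forbidden:
  "verts (forbidden q) =
    {Inl 0, Inr (Inl 0), Inr (Inl 1)} \<union> (\<lambda>i. Inr (Inr (i, 0))) ` {..<q}"
  by (auto simp: forbidden_def join_def disjoint_union_def copies_def complete_graph_def
      less_2_cases_iff)

lemma edges_forbidden:
  "edges (forbidden q) =
    {{Inl 0, Inr (Inl 0)}, {Inl 0, Inr (Inl 1)}, {Inr (Inl 0), Inr (Inl 1)}} \<union>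
    (\<lambda>i. {Inl 0, Inr (Inr (i, 0))}) ` {..<q}"
proof -
  have V: "verts (complete_graph 1) = {0}" "verts (complete_graph 2) = {0, 1}"
    "verts (copies q (complete_graph 1)) = (\<lambda>i. (i, 0)) ` {..<q}"
    by (auto simp: complete_graph_def copies_def)
  have 1: "edges (complete_graph 1) = {}"
    by (auto simp: complete_graph_def lessThan_Suc subset_singleton_iff)
  have "e \<subseteq> {0, 1::nat} \<and> card e = 2 \<longleftrightarrow> e = {0, 1}" for e
  proof
    show "e = {0, 1}" if "e \<subseteq> {0, 1} \<and> card e = 2"
      using that by (intro card_two_subset_pair) (erule conjunct1, erule conjunct2)
  qed (simp add: card_insert_if)
  moreover have "{..<2::nat} = {0, 1}" by auto
  ultimately have 2: "edges (complete_graph 2) = {{0, 1}}"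
    unfolding complete_graph_def graph.simps by simp
  have 3: "edges (copies q (complete_graph 1)) = {}"
    unfolding copies_def 1 by simp
  show ?thesis
    unfolding forbidden_def join_def disjoint_union_def 1 2 3 V graph.simps by auto
qed

section \<open>Neighbourhoods and the degree criterion for a forbidden copy\<close>

definition nbrs :: "'a graph \<Rightarrow> 'a \<Rightarrow> 'a set" where
  "nbrs G v = {u. {u, v} \<in> edges G}"

lemma nbrs_sym: "u \<in> nbrs G v \<longleftrightarrow> v \<in> nbrs G u"
  by (simp add: nbrs_def insert_commute)

lemma nbrs_irrefl: "simple_graph G \<Longrightarrow> v \<notin> nbrs G v"
  by (auto simp: nbrs_def simple_graph_def)

lemma nbrs_subset: "simple_graph G \<Longrightarrow> nbrs G v \<subseteq> verts G"
  by (auto simp: nbrs_def simple_graph_def)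

lemma finite_nbrs: "simple_graph G \<Longrightarrow> finite (nbrs G v)"
  by (meson finite_subset nbrs_subset simple_graph_def)

text \<open>Apart from the triangle at the apex \<open>c\<close>, a copy asks only for
  \<open>q\<close> more neighbours of \<open>c\<close>, with no edges required among them. Any
  neighbours other than \<open>x\<close> and \<open>y\<close> will do, so a bound on the degree
  suffices.\<close>

lemma contains_forbidden_iff:
  assumes G: "simple_graph G"
  shows "contains_copy G (forbidden q) \<longleftrightarrow>
    (\<exists>c x y. x \<in> nbrs G c \<and> y \<in> nbrs G c \<and> x \<in> nbrs G y \<and> q + 2 \<le> card (nbrs G c))"
    (is "?L \<longleftrightarrow> ?R")
proof
  assume ?L
  then obtain f where f: "inj_on f (verts (forbidden q))"
    "\<forall>e\<in>edges (forbidden q). f ` e \<in> edges G"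
    using contains_copy_iff_embedding[OF simple_graph_forbidden G] by metis
  let ?c = "f (Inl 0)" and ?x = "f (Inr (Inl 0))" and ?y = "f (Inr (Inl 1))"
  \<comment> \<open>The apex is adjacent to all the other \<open>q + 2\<close> vertices, so their
    distinct images are neighbours of \<open>?c\<close>.\<close>
  let ?W = "verts (forbidden q) - {Inl 0}"
  have sub: "f ` ?W \<subseteq> nbrs G ?c" and xy: "?x \<in> nbrs G ?y"
    using f(2) by (auto simp: edges_forbidden verts_forbidden nbrs_def insert_commute)
  have "?W = {Inr (Inl 0), Inr (Inl 1)} \<union> (\<lambda>i. Inr (Inr (i, 0))) ` {..<q}"
    by (auto simp: verts_forbidden)
  also have "card \<dots> = q + 2"
    by (subst card_Un_disjoint) (auto simp: card_image inj_on_def)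
  finally have "card (f ` ?W) = q + 2"
    using f(1) by (subst card_image) (auto intro: inj_on_subset)
  then have "q + 2 \<le> card (nbrs G ?c)"
    using card_mono[OF finite_nbrs[OF G] sub] by simp
  moreover have "?x \<in> nbrs G ?c" "?y \<in> nbrs G ?c"
    using sub by (auto simp: verts_forbidden)
  ultimately show ?R using xy by blast
next
  assume ?R
  then obtain c x y where cxy: "x \<in> nbrs G c" "y \<in> nbrs G c" "x \<in> nbrs G y"
    and deg: "q + 2 \<le> card (nbrs G c)" by blast
  have ne: "x \<noteq> y" "x \<noteq> c" "y \<noteq> c" using cxy nbrs_irrefl[OF G] by auto
  have "card (nbrs G c - {x, y}) \<ge> q"
    using deg cxy ne finite_nbrs[OF G, of c] by (simp add: card_Diff_subset)
  \<comment> \<open>\<open>Z\<close> will receive the \<open>q\<close> vertices of qK_1.\<close>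
  then obtain Z where Z: "Z \<subseteq> nbrs G c - {x, y}" "card Z = q" "finite Z"
    by (meson obtain_subset_with_card_n)
  then obtain g where g: "bij_betw g {..<q} Z"
    using ex_bij_betw_nat_finite lessThan_atLeast0 by metis
  \<comment> \<open>The apex goes to \<open>c\<close>, the ends of K_2 go to \<open>x\<close> and
    \<open>y\<close>, and the copy of K_1 with index \<open>i\<close> goes to
    \<open>g i\<close>.\<close>
  let ?f = "case_sum (\<lambda>_. c) (case_sum (\<lambda>i::nat. if i = 0 then x else y) (\<lambda>(i, _::nat). g i))"
  have gi: "g i \<in> nbrs G c" "g i \<noteq> x" "g i \<noteq> y" "g i \<noteq> c" if "i < q" for i
  proof -
    have "g i \<in> Z" using g that by (auto dest: bij_betwE)
    then show "g i \<in> nbrs G c" "g i \<noteq> x" "g i \<noteq> y" "g i \<noteq> c"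
      using Z(1) nbrs_irrefl[OF G, of c] by auto
  qed
  have ginj: "inj_on g {..<q}" using g by (simp add: bij_betw_def)
  have "inj_on ?f (verts (forbidden q))"
    unfolding verts_forbidden using ne gi ginj
    by (auto simp: inj_on_def)
  moreover have "?f ` verts (forbidden q) \<subseteq> verts G"
  proof -
    have "c \<in> verts G" using cxy(1) nbrs_subset[OF G] by (auto simp: nbrs_sym[of x])
    then show ?thesis
      using cxy gi nbrs_subset[OF G, of c] by (auto simp: verts_forbidden)
  qed
  moreover have "\<forall>e\<in>edges (forbidden q). ?f ` e \<in> edges G"
    using cxy gi by (auto simp: edges_forbidden nbrs_def insert_commute)
  ultimately show ?L
    unfolding contains_copy_iff_embedding[OF simple_graph_forbidden G] by (intro exI[of _ ?f]) blast
qed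

lemma simple_graph_add_edge:
  assumes "simple_graph G" "u \<in> verts G" "v \<in> verts G" "u \<noteq> v"
  shows "simple_graph (add_edge G {u, v})"
  using assms by (auto simp: simple_graph_def add_edge_def)

lemma nbrs_add_edge:
  "nbrs (add_edge G {u, v}) w =
    nbrs G w \<union> (if w = u then {v} else {}) \<union> (if w = v then {u} else {})"
  by (auto simp: nbrs_def add_edge_def doubleton_eq_iff)

lemma saturated_iff_nonadjacent:
  assumes G: "simple_graph G"
  shows "saturated F G \<longleftrightarrow> \<not> contains_copy G F \<and>
    (\<forall>u\<in>verts G. \<forall>v\<in>verts G. u \<noteq> v \<longrightarrow> u \<notin> nbrs G v \<longrightarrow> contains_copy (add_edge G {u, v}) F)"
proof -
  have "edges (complement G) = {{u, v} |u v. u \<in> verts G \<and> v \<in> verts G \<and> u \<noteq> v \<and> u \<notin> nbrs G v}"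
    by (auto simp: complement_def nbrs_def card_2_iff)
  then have "(\<forall>e\<in>edges (complement G). Q e) \<longleftrightarrow>
    (\<forall>u\<in>verts G. \<forall>v\<in>verts G. u \<noteq> v \<longrightarrow> u \<notin> nbrs G v \<longrightarrow> Q {u, v})" for Q
    by (simp only:) blast
  then show ?thesis unfolding saturated_def by (rule arg_cong)
qed

section \<open>Stars with disjoint triangles\<close>

text \<open>The graphs \<open>aK\<^sub>3 \<union> S\<^sub>m\<close> with \<open>a = card P\<close> and \<open>m = card C\<close>, up to isomorphism.\<close>

definition triangle_star :: "'a graph \<Rightarrow> 'a set \<Rightarrow> 'a \<Rightarrow> 'a set set \<Rightarrow> bool" where
  "triangle_star G C c P \<longleftrightarrow>
     finite C \<and> c \<in> C \<and> finite P \<and> (\<forall>B\<in>P. card B = 3 \<and> B \<inter> C = {}) \<and>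
     (\<forall>A\<in>P. \<forall>B\<in>P. A \<noteq> B \<longrightarrow> A \<inter> B = {}) \<and>
     verts G = C \<union> \<Union>P \<and>
     edges G = (\<lambda>v. {c, v}) ` (C - {c}) \<union> (\<Union>B\<in>P. {e. e \<subseteq> B \<and> card e = 2})"

lemma triangle_star_finite_block: "triangle_star G C c P \<Longrightarrow> B \<in> P \<Longrightarrow> finite B"
  by (metis triangle_star_def card.infinite zero_neq_numeral)

lemma triangle_star_block_disjoint:
  "triangle_star G C c P \<Longrightarrow> B \<in> P \<Longrightarrow> v \<in> B \<Longrightarrow> v \<notin> C"
  by (auto simp: triangle_star_def)

lemma triangle_star_block_unique:
  "triangle_star G C c P \<Longrightarrow> A \<in> P \<Longrightarrow> B \<in> P \<Longrightarrow> v \<in> A \<Longrightarrow> v \<in> B \<Longrightarrow> A = B"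
  by (auto simp: triangle_star_def)

lemma triangle_star_centre: "triangle_star G C c P \<Longrightarrow> c \<in> C"
  by (auto simp: triangle_star_def)

lemma simple_graph_triangle_star:
  assumes "triangle_star G C c P"
  shows "simple_graph G"
  using assms triangle_star_finite_block[OF assms]
  by (auto simp: triangle_star_def simple_graph_def)

lemma card_verts_triangle_star:
  assumes "triangle_star G C c P"
  shows "card (verts G) = card C + 3 * card P"
proof -
  have "card (\<Union>P) = (\<Sum>B\<in>P. card B)"
    using assms triangle_star_finite_block[OF assms]
    by (intro card_Union_disjoint) (auto simp: triangle_star_def pairwise_def disjnt_def)
  also have "\<dots> = 3 * card P" using assms by (simp add: triangle_star_def)
  finally show ?thesis
    using assms triangle_star_finite_block[OF assms]
    by (subst (asm) triangle_star_def, simp, subst card_Un_disjoint) auto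
qed

text \<open>A triangle has as many edges as vertices and the star has one fewer, so the total is one
  less than the number of vertices, however many triangles there are.\<close>

lemma card_edges_triangle_star:
  assumes ts: "triangle_star G C c P"
  shows "card (edges G) = card C - 1 + 3 * card P"
proof -
  note [simp] = triangle_star_finite_block[OF ts]
  let ?S = "\<lambda>B. {e. e \<subseteq> B \<and> card e = 2}"
  have fin: "finite (?S B)" if "B \<in> P" for B using that by simp
  have three: "card (?S B) = 3" if "B \<in> P" for B
  proof -
    have "card (?S B) = 3 choose 2"
      using n_subsets[of B 2] ts that by (simp add: triangle_star_def)
    then show ?thesis by (simp add: numeral_eq_Suc)
  qed
  have disj: "?S A \<inter> ?S B = {}" if "A \<in> P" "B \<in> P" "A \<noteq> B" for A B
  proof -
    have AB: "A \<inter> B = {}" using ts that by (simp add: triangle_star_def)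
    have "card e = 0" if "e \<subseteq> A" "e \<subseteq> B" for e
    proof -
      have "e \<subseteq> {}" using that AB by blast
      then show ?thesis by simp
    qed
    then show ?thesis by fastforce
  qed
  have "card (\<Union>B\<in>P. ?S B) = (\<Sum>B\<in>P. card (?S B))"
    using ts fin disj by (intro card_UN_disjoint) (auto simp: triangle_star_def)
  also have "\<dots> = 3 * card P" using three by simp
  finally have U: "card (\<Union>B\<in>P. ?S B) = 3 * card P" .
  have S: "card ((\<lambda>v. {c, v}) ` (C - {c})) = card C - 1"
    using ts by (subst card_image) (auto simp: triangle_star_def inj_on_def doubleton_eq_iff)
  have "(\<lambda>v. {c, v}) ` (C - {c}) \<inter> (\<Union>B\<in>P. ?S B) = {}"
    using triangle_star_block_disjoint[OF ts] triangle_star_centre[OF ts] by blast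
  moreover have "finite ((\<lambda>v. {c, v}) ` (C - {c}))" "finite (\<Union>B\<in>P. ?S B)"
    using ts fin by (auto simp: triangle_star_def)
  ultimately have "card ((\<lambda>v. {c, v}) ` (C - {c}) \<union> (\<Union>B\<in>P. ?S B)) = card C - 1 + 3 * card P"
    using U S by (subst card_Un_disjoint) simp_all
  moreover have "edges G = (\<lambda>v. {c, v}) ` (C - {c}) \<union> (\<Union>B\<in>P. ?S B)"
    using ts by (simp add: triangle_star_def)
  ultimately show ?thesis by simp
qed

lemma nbrs_triangle_star_iff:
  assumes ts: "triangle_star G C c P"
  shows "x \<in> nbrs G v \<longleftrightarrow>
    v = c \<and> x \<in> C - {c} \<or> x = c \<and> v \<in> C - {c} \<or> (\<exists>B\<in>P. x \<in> B \<and> v \<in> B \<and> x \<noteq> v)"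
proof -
  have "{x, v} \<in> (\<lambda>v. {c, v}) ` (C - {c}) \<longleftrightarrow> v = c \<and> x \<in> C - {c} \<or> x = c \<and> v \<in> C - {c}"
    by (simp only: image_iff doubleton_eq_iff) blast
  moreover have "{x, v} \<subseteq> B \<and> card {x, v} = 2 \<longleftrightarrow> x \<in> B \<and> v \<in> B \<and> x \<noteq> v" for B
    by (auto simp: card_insert_if)
  moreover have "edges G = (\<lambda>v. {c, v}) ` (C - {c}) \<union> (\<Union>B\<in>P. {e. e \<subseteq> B \<and> card e = 2})"
    using ts by (simp add: triangle_star_def)
  ultimately show ?thesis
    by (simp only: nbrs_def mem_Collect_eq Un_iff UN_iff disj_assoc)
qed

lemma nbrs_triangle_star_centre:
  assumes "triangle_star G C c P"
  shows "nbrs G c = C - {c}"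
  using triangle_star_block_disjoint[OF assms] triangle_star_centre[OF assms]
  by (auto simp: nbrs_triangle_star_iff[OF assms])

lemma nbrs_triangle_star_leaf:
  assumes "triangle_star G C c P" "v \<in> C" "v \<noteq> c"
  shows "nbrs G v = {c}"
  using triangle_star_block_disjoint[OF assms(1)] assms
  by (auto simp: nbrs_triangle_star_iff[OF assms(1)])

lemma nbrs_triangle_star_block:
  assumes "triangle_star G C c P" "B \<in> P" "v \<in> B"
  shows "nbrs G v = B - {v}"
proof -
  have block: "(\<exists>A\<in>P. x \<in> A \<and> v \<in> A \<and> x \<noteq> v) \<longleftrightarrow> x \<in> B \<and> x \<noteq> v" for x
  proof
    show "x \<in> B \<and> x \<noteq> v" if "\<exists>A\<in>P. x \<in> A \<and> v \<in> A \<and> x \<noteq> v"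
      using that triangle_star_block_unique[OF assms(1,2) _ assms(3)] by blast
  qed (use assms in blast)
  have "v \<notin> C" "v \<noteq> c"
    using triangle_star_block_disjoint[OF assms] triangle_star_centre[OF assms(1)] by auto
  then have "x \<in> nbrs G v \<longleftrightarrow> x \<in> B \<and> x \<noteq> v" for x
    unfolding nbrs_triangle_star_iff[OF assms(1)] block by simp
  then show ?thesis by blast
qed

text \<open>Only block vertices lie on triangles, and their degree 2 is below \<open>q + 2\<close>.
  A new edge at a block vertex raises its degree to 3, which is enough for \<open>q = 1\<close>. A
  new edge between two leaves closes a triangle at \<open>c\<close>, whose degree is
  \<open>card C - 1\<close>.\<close>

lemma saturated_triangle_star:
  assumes ts: "triangle_star G C c P" and "q \<ge> 1"
    and q: "q = 1 \<and> card C \<noteq> 3 \<or> P = {} \<and> card C \<ge> q + 3"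
  shows "saturated (forbidden q) G"
proof -
  note G = simple_graph_triangle_star[OF ts]
  have finC: "finite C" "c \<in> C" and V: "verts G = C \<union> \<Union>P"
    and card3: "\<And>B. B \<in> P \<Longrightarrow> card B = 3"
    using ts by (auto simp: triangle_star_def)
  have "\<not> contains_copy G (forbidden q)"
  proof
    assume "contains_copy G (forbidden q)"
    then obtain w x y where wxy: "x \<in> nbrs G w" "y \<in> nbrs G w" "x \<in> nbrs G y"
      and deg: "q + 2 \<le> card (nbrs G w)"
      using contains_forbidden_iff[OF G] by blast
    have "w \<in> verts G" using wxy(1) nbrs_subset[OF G] nbrs_sym by fast
    then consider "w = c" | "w \<in> C" "w \<noteq> c" | B where "B \<in> P" "w \<in> B" using V by blast
    then show False
    proof cases
      case 1
      then have "x \<in> C - {c}" "y \<in> C - {c}" using wxy nbrs_triangle_star_centre[OF ts] by auto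
      then show False using wxy(3) nbrs_triangle_star_leaf[OF ts] by auto
    next
      case 2
      then show False using deg nbrs_triangle_star_leaf[OF ts] by simp
    next
      case 3
      then show False
        using deg nbrs_triangle_star_block[OF ts] card3[of B] \<open>q \<ge> 1\<close>
          triangle_star_finite_block[OF ts] by simp
    qed
  qed
  moreover have "contains_copy (add_edge G {u, v}) (forbidden q)"
    if uv: "u \<in> verts G" "v \<in> verts G" "u \<noteq> v" "u \<notin> nbrs G v" for u v
  proof -
    \<comment> \<open>Stated for arbitrary \<open>u\<close> and \<open>v\<close>, since it is
      applied to whichever end of the new edge lies in a block.\<close>
    have block: "contains_copy (add_edge G {u, v}) (forbidden q)"
      if uv: "u \<in> verts G" "v \<in> verts G" "u \<noteq> v" "u \<notin> nbrs G v"
        and B: "B \<in> P" "u \<in> B" for u v B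
    proof -
      have nu: "nbrs G u = B - {u}" by (rule nbrs_triangle_star_block[OF ts B])
      have "card (B - {u}) = 2" using card3 B triangle_star_finite_block[OF ts] by simp
      then obtain x y where xy: "B - {u} = {x, y}" "x \<noteq> y" by (auto simp: card_2_iff)
      have "nbrs G y = B - {y}" using xy B nbrs_triangle_star_block[OF ts, of B y] by auto
      then have x: "x \<in> nbrs G y" using xy by auto
      have "v \<notin> {x, y}" using uv(4) nu xy nbrs_sym[of u G v] by auto
      then have "card (nbrs (add_edge G {u, v}) u) = 3"
        using xy nu uv by (auto simp: nbrs_add_edge)
      \<comment> \<open>A block exists, so only the first alternative of the assumption remains, and
        degree 3 is exactly \<open>q + 2\<close>.\<close>
      moreover have "q = 1" using q B by auto
      moreover have "x \<in> nbrs G u" "y \<in> nbrs G u" using nu xy by auto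
      ultimately show ?thesis
        unfolding contains_forbidden_iff[OF simple_graph_add_edge[OF G uv(1-3)]]
        using x by (intro exI[of _ u] exI[of _ x] exI[of _ y]) (simp add: nbrs_add_edge)
    qed
    show ?thesis
    proof (cases "u \<in> C \<and> v \<in> C")
      case True
      have uc: "u \<noteq> c" "v \<noteq> c"
        using uv nbrs_triangle_star_centre[OF ts] True nbrs_sym[of u G v] by auto
      have "card {c, u, v} \<le> card C" using True finC by (intro card_mono) auto
      then have "3 \<le> card C" using uc uv by auto
      \<comment> \<open>For \<open>q = 1\<close> the value 3 is excluded, so \<open>card C\<close>
        is at least 4; otherwise the bound is assumed.\<close>
      then have "card C \<ge> q + 3" using q by auto
      moreover have "nbrs (add_edge G {u, v}) c = C - {c}"
        using uc by (simp add: nbrs_add_edge nbrs_triangle_star_centre[OF ts])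
      ultimately show ?thesis
        unfolding contains_forbidden_iff[OF simple_graph_add_edge[OF G uv(1-3)]]
        using True uc finC
        by (intro exI[of _ c] exI[of _ u] exI[of _ v]) (simp add: nbrs_add_edge)
    next
      case False
      then obtain B where "B \<in> P" "u \<in> B \<or> v \<in> B" using uv V by blast
      then show ?thesis
        using block[of u v B] block[of v u B] uv nbrs_sym[of u G v]
        by (auto simp: insert_commute)
    qed
  qed
  ultimately show ?thesis unfolding saturated_iff_nonadjacent[OF G] by blast
qed

section \<open>Isomorphisms between stars with triangles\<close>

lemma image_doubletons:
  assumes "inj_on f B"
  shows "(\<lambda>e. f ` e) ` {e. e \<subseteq> B \<and> card e = 2} = {e. e \<subseteq> f ` B \<and> card e = 2}"
proof (intro set_eqI iffI)
  fix e assume "e \<in> (\<lambda>e. f ` e) ` {e. e \<subseteq> B \<and> card e = 2}"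
  then obtain d where d: "e = f ` d" "d \<subseteq> B" "card d = 2" by blast
  then have "card e = 2"
    using card_image[OF inj_on_subset[OF assms d(2)]] by simp
  then show "e \<in> {e. e \<subseteq> f ` B \<and> card e = 2}" using d by auto
next
  fix e assume "e \<in> {e. e \<subseteq> f ` B \<and> card e = 2}"
  then obtain d where d: "d \<subseteq> B" "e = f ` d" "card e = 2"
    by (auto simp: subset_image_iff)
  then have "card d = 2"
    using card_image[OF inj_on_subset[OF assms d(1)]] by simp
  then show "e \<in> (\<lambda>e. f ` e) ` {e. e \<subseteq> B \<and> card e = 2}" using d by auto
qed

text \<open>The isomorphism carries the star, its centre and the blocks to their images; injectivity
  keeps sizes, disjointness and the number of blocks.\<close>

lemma triangle_star_iso:
  assumes ts: "triangle_star G C c P" and iso: "G \<cong>\<^sub>G H"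
  shows "\<exists>D d Q. triangle_star H D d Q \<and> card D = card C \<and> card Q = card P"
proof -
  obtain f where bij: "bij_betw f (verts G) (verts H)" and E: "edges H = (\<lambda>e. f ` e) ` edges G"
    using iso by (auto simp: graph_iso_def)
  have V: "verts G = C \<union> \<Union>P" and c: "c \<in> C"
    and EG: "edges G = (\<lambda>v. {c, v}) ` (C - {c}) \<union> (\<Union>B\<in>P. {e. e \<subseteq> B \<and> card e = 2})"
    using ts by (auto simp: triangle_star_def)
  have inj: "inj_on f (C \<union> \<Union>P)" and VH: "verts H = f ` (C \<union> \<Union>P)"
    using bij V by (auto simp: bij_betw_def)
  have disj: "f ` A \<inter> f ` B = {}" if "A \<inter> B = {}" "A \<subseteq> C \<union> \<Union>P" "B \<subseteq> C \<union> \<Union>P" for A B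
    using inj_on_image_Int[OF inj that(2,3)] that(1) by simp
  have injB: "inj_on f B" if "B \<in> P" for B
    using inj_on_subset[OF inj] that by blast
  have fC: "f ` (C - {c}) = f ` C - {f c}"
    using inj_on_image_set_diff[OF inj, of C "{c}"] c by auto
  have "edges H = (\<lambda>v. {f c, v}) ` (f ` C - {f c}) \<union>
      (\<Union>B\<in>P. (\<lambda>e. f ` e) ` {e. e \<subseteq> B \<and> card e = 2})"
    unfolding E EG fC[symmetric] by (simp add: image_Un image_image image_UN)
  also have "(\<Union>B\<in>P. (\<lambda>e. f ` e) ` {e. e \<subseteq> B \<and> card e = 2})
      = (\<Union>B\<in>(`) f ` P. {e. e \<subseteq> B \<and> card e = 2})"
    using image_doubletons[OF injB] by simp
  finally have EH: "edges H = (\<lambda>v. {f c, v}) ` (f ` C - {f c}) \<union>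
      (\<Union>B\<in>(`) f ` P. {e. e \<subseteq> B \<and> card e = 2})" .
  have "\<forall>B\<in>(`) f ` P. card B = 3 \<and> B \<inter> f ` C = {}"
  proof
    fix B assume "B \<in> (`) f ` P"
    then obtain A where A: "A \<in> P" "B = f ` A" by blast
    then have "card A = 3" "A \<inter> C = {}" using ts by (auto simp: triangle_star_def)
    then show "card B = 3 \<and> B \<inter> f ` C = {}"
      using A card_image[OF injB[OF A(1)]] disj[of A C] by auto
  qed
  moreover have "\<forall>A\<in>(`) f ` P. \<forall>B\<in>(`) f ` P. A \<noteq> B \<longrightarrow> A \<inter> B = {}"
  proof (intro ballI impI)
    fix A B assume "A \<in> (`) f ` P" "B \<in> (`) f ` P" "A \<noteq> B"
    then obtain A' B' where AB: "A' \<in> P" "B' \<in> P" "A = f ` A'" "B = f ` B'" "A' \<noteq> B'" by blast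
    then have "A' \<inter> B' = {}" using ts by (simp add: triangle_star_def)
    then show "A \<inter> B = {}" using disj[of A' B'] AB by auto
  qed
  moreover have "verts H = f ` C \<union> \<Union>((`) f ` P)" using VH by (auto simp: image_Un)
  ultimately have "triangle_star H (f ` C) (f c) ((`) f ` P)"
    using EH ts c by (simp add: triangle_star_def)
  moreover have "card (f ` C) = card C"
    using inj by (intro card_image) (auto intro: inj_on_subset)
  moreover have "card ((`) f ` P) = card P"
  proof (rule card_image, rule inj_onI)
    fix A B assume "A \<in> P" "B \<in> P" "f ` A = f ` B"
    then show "A = B" using inj_on_image_eq_iff[OF inj, of A B] by blast
  qed
  ultimately show ?thesis by blast
qed

text \<open>Serves to match two stars of equal size with centre going to centre.\<close>

lemma bij_betw_fixing_point:
  assumes "finite C" "finite D" "card C = card D" "c \<in> C" "d \<in> D"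
  obtains h where "bij_betw h C D" "h c = d"
proof -
  have "card (C - {c}) = card (D - {d})" using assms by simp
  then obtain g where "bij_betw g (C - {c}) (D - {d})"
    using assms finite_same_card_bij by blast
  then have "bij_betw (g(c := d)) (C - {c}) (D - {d})"
    by (subst bij_betw_cong[of _ _ g]) auto
  then have "bij_betw (g(c := d)) (C - {c} \<union> {c}) (D - {d} \<union> {(g(c := d)) c})"
    by (intro notIn_Un_bij_betw) auto
  then show ?thesis using that[of "g(c := d)"] assms by (simp add: insert_absorb)
qed

text \<open>The two sizes determine the graph: a bijection of the stars that respects the centres is
  glued to bijections between matched blocks. Within a block every pair is an edge, so any bijection
  works there.\<close>

lemma triangle_star_isomorphic:
  assumes G: "triangle_star G C c P" and H: "triangle_star H D d Q"
    and cards: "card C = card D" "card P = card Q"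
  shows "G \<cong>\<^sub>G H"
proof -
  note fG = triangle_star_finite_block[OF G] and fH = triangle_star_finite_block[OF H]
  have finC: "finite C" "finite D" and finP: "finite P" "finite Q"
    using G H by (auto simp: triangle_star_def)
  have VG: "verts G = C \<union> \<Union>P" and VH: "verts H = D \<union> \<Union>Q"
    using G H by (auto simp: triangle_star_def)
  have EG: "edges G = (\<lambda>v. {c, v}) ` (C - {c}) \<union> (\<Union>B\<in>P. {e. e \<subseteq> B \<and> card e = 2})"
    and EH: "edges H = (\<lambda>v. {d, v}) ` (D - {d}) \<union> (\<Union>B\<in>Q. {e. e \<subseteq> B \<and> card e = 2})"
    using G H by (simp_all add: triangle_star_def)
  note c = triangle_star_centre[OF G] and d = triangle_star_centre[OF H]
  obtain h where h: "bij_betw h C D" "h c = d"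
    using bij_betw_fixing_point[OF finC cards(1) c d] .
  obtain \<beta> where \<beta>: "bij_betw \<beta> P Q"
    using finite_same_card_bij[OF finP cards(2)] by blast
  have "\<exists>g. bij_betw g B (\<beta> B)" if "B \<in> P" for B
  proof -
    have "\<beta> B \<in> Q" using \<beta> that by (auto dest: bij_betwE)
    moreover from this that have "card B = card (\<beta> B)" using G H by (simp add: triangle_star_def)
    ultimately show ?thesis using finite_same_card_bij[of B "\<beta> B"] fG fH that by blast
  qed
  then obtain \<gamma> where \<gamma>: "\<And>B. B \<in> P \<Longrightarrow> bij_betw (\<gamma> B) B (\<beta> B)" by metis
  \<comment> \<open>Each vertex outside \<open>C\<close> lies in exactly one block, which the
    description selects.\<close>
  define f where "f v = (if v \<in> C then h v else \<gamma> (THE B. B \<in> P \<and> v \<in> B) v)" for v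
  have fC: "f v = h v" if "v \<in> C" for v using that by (simp add: f_def)
  have fB: "f v = \<gamma> B v" if "B \<in> P" "v \<in> B" for v B
  proof -
    have "(THE B. B \<in> P \<and> v \<in> B) = B"
      using that triangle_star_block_unique[OF G] by (intro the_equality) auto
    then show ?thesis using triangle_star_block_disjoint[OF G that] by (simp add: f_def)
  qed
  have imC: "f ` C = D" using h(1) fC by (simp add: bij_betw_def cong: image_cong)
  have imB: "f ` B = \<beta> B" if "B \<in> P" for B
    using \<gamma>[OF that] fB[OF that] by (simp add: bij_betw_def cong: image_cong)
  have "(`) f ` P = Q"
    using imB \<beta> by (simp add: bij_betw_def cong: image_cong)
  then have imP: "f ` \<Union>P = \<Union>Q" by (simp add: image_Union)
  have imV: "f ` verts G = verts H" by (simp add: VG VH image_Un imC imP)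
  \<comment> \<open>Injectivity comes from counting: \<open>f\<close> maps \<open>verts G\<close>
    onto a set of the same finite size.\<close>
  have "finite (verts G)"
    using simple_graph_triangle_star[OF G] by (simp add: simple_graph_def)
  then have inj: "inj_on f (verts G)"
    using card_verts_triangle_star[OF G] card_verts_triangle_star[OF H] cards
    by (intro eq_card_imp_inj_on) (simp_all add: imV)
  have injB: "inj_on f B" if "B \<in> P" for B
    using inj_on_subset[OF inj] that VG by blast
  have star: "(\<lambda>e. f ` e) ` (\<lambda>v. {c, v}) ` (C - {c}) = (\<lambda>v. {d, v}) ` (D - {d})"
  proof -
    have "f c = d" using fC c h(2) by simp
    moreover have "f ` (C - {c}) = D - {d}"
      using inj_on_image_set_diff[OF inj, of C "{c}"] c VG imC \<open>f c = d\<close> by auto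
    ultimately show ?thesis by (simp add: image_image flip: \<open>f ` (C - {c}) = D - {d}\<close>)
  qed
  have "(\<lambda>e. f ` e) ` {e. e \<subseteq> B \<and> card e = 2} = {e. e \<subseteq> \<beta> B \<and> card e = 2}" if "B \<in> P" for B
    using image_doubletons[OF injB[OF that]] imB[OF that] by simp
  then have "(\<lambda>e. f ` e) ` (\<Union>B\<in>P. {e. e \<subseteq> B \<and> card e = 2})
      = (\<Union>B\<in>\<beta> ` P. {e. e \<subseteq> B \<and> card e = 2})"
    by (simp add: image_UN)
  also have "\<beta> ` P = Q" using \<beta> by (simp add: bij_betw_def)
  finally have "edges H = (\<lambda>e. f ` e) ` edges G"
    using star unfolding EG EH image_Un by simp
  moreover have "bij_betw f (verts G) (verts H)"
    using inj imV by (simp add: bij_betw_def)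
  ultimately show ?thesis by (auto simp: graph_iso_def)
qed

text \<open>In a simple graph every edge lies inside \<open>verts G\<close>, where the inverse of
  \<open>f\<close> cancels \<open>f\<close>.\<close>

lemma graph_iso_sym:
  assumes G: "simple_graph G" and iso: "G \<cong>\<^sub>G H"
  shows "H \<cong>\<^sub>G G"
proof -
  obtain f where f: "bij_betw f (verts G) (verts H)" and E: "edges H = (\<lambda>e. f ` e) ` edges G"
    using iso by (auto simp: graph_iso_def)
  let ?g = "inv_into (verts G) f"
  have "?g ` f ` e = e" if "e \<in> edges G" for e
    using that G f by (intro inv_into_image_cancel) (auto simp: simple_graph_def bij_betw_def)
  then have "edges G = (\<lambda>e. ?g ` e) ` edges H"
    by (simp add: E image_image)
  moreover have "bij_betw ?g (verts H) (verts G)" using f by (rule bij_betw_inv_into)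
  ultimately show ?thesis by (auto simp: graph_iso_def)
qed

lemma triangle_star_star:
  assumes "m \<ge> 1"
  shows "triangle_star (star m) {..<m} 0 {}"
  using assms by (auto simp: triangle_star_def star_def)

lemma triangle_star_copies:
  assumes "m \<ge> 1"
  shows "\<exists>C c P. triangle_star (copies a (complete_graph 3) \<union>\<^sub>G star m) C c P \<and>
    card C = m \<and> card P = a"
proof -
  \<comment> \<open>\<open>T i\<close> is the triangle with index \<open>i\<close> and
    \<open>C\<close> is the star, both as embedded in the sum type.\<close>
  define T :: "nat \<Rightarrow> ((nat \<times> nat) + nat) set" where "T i = Inl ` Pair i ` {..<3}" for i
  define C where "C = (Inr ` {..<m} :: ((nat \<times> nat) + nat) set)"
  let ?G = "copies a (complete_graph 3) \<union>\<^sub>G star m"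
  have injT: "inj_on (\<lambda>j. Inl (i, j) :: (nat \<times> nat) + nat) {..<3}" for i
    by (simp add: inj_on_def)
  have T': "T i = (\<lambda>j. Inl (i, j)) ` {..<3}" for i by (simp add: T_def image_image)
  have cardT: "card (T i) = 3" for i
    unfolding T' using card_image[OF injT] by simp
  have V: "verts ?G = C \<union> \<Union>(T ` {..<a})"
    by (auto simp: disjoint_union_def copies_def complete_graph_def star_def C_def T_def)
  have "edges (copies a (complete_graph 3)) =
      (\<Union>i<a. (\<lambda>e. Pair i ` e) ` {e. e \<subseteq> {..<3} \<and> card e = 2})"
    by (auto simp: copies_def complete_graph_def)
  then have E1: "(\<lambda>e. Inl ` e) ` edges (copies a (complete_graph 3)) =
      (\<Union>B\<in>T ` {..<a}. {e. e \<subseteq> B \<and> card e = 2})"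
    by (simp add: T' image_image image_UN image_doubletons[OF injT, symmetric])
  have E2: "(\<lambda>e. Inr ` e) ` edges (star m) = (\<lambda>v. {Inr 0, v}) ` (C - {Inr 0})"
  proof -
    have "edges (star m) = (\<lambda>v. {0, v}) ` ({..<m} - {0})" by (auto simp: star_def)
    moreover have "C - {Inr 0} = Inr ` ({..<m} - {0})" by (auto simp: C_def)
    ultimately show ?thesis by (simp add: image_image)
  qed
  have E: "edges ?G = (\<lambda>v. {Inr 0, v}) ` (C - {Inr 0}) \<union>
      (\<Union>B\<in>T ` {..<a}. {e. e \<subseteq> B \<and> card e = 2})"
    unfolding E1[symmetric] E2[symmetric] by (auto simp: disjoint_union_def)
  have "triangle_star ?G C (Inr 0) (T ` {..<a})"
    unfolding triangle_star_def
    using assms V E cardT by (auto simp: C_def T_def)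
  moreover have "card C = m" by (simp add: C_def card_image)
  moreover have "card (T ` {..<a}) = a"
  proof -
    have "inj T" by (rule injI) (force simp: T_def)
    then show ?thesis by (simp add: card_image inj_on_subset)
  qed
  ultimately show ?thesis by blast
qed

text \<open>Turns isomorphism with a concrete star into the intrinsic description: one direction
  transports the structure, the other uses that the sizes determine the graph.\<close>

lemma iso_star_iff:
  assumes "simple_graph G" "m \<ge> 1"
  shows "G \<cong>\<^sub>G star m \<longleftrightarrow> (\<exists>C c. triangle_star G C c {} \<and> card C = m)"
proof
  assume "G \<cong>\<^sub>G star m"
  then obtain D d Q where "triangle_star G D d Q" "card D = card {..<m}" "card Q = card ({} :: nat set set)"
    using triangle_star_iso[OF triangle_star_star[OF assms(2)] graph_iso_sym[OF assms(1)]] by blast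
  moreover from this have "Q = {}" by (auto simp: triangle_star_def)
  ultimately show "\<exists>C c. triangle_star G C c {} \<and> card C = m" by auto
next
  assume "\<exists>C c. triangle_star G C c {} \<and> card C = m"
  then obtain C c where "triangle_star G C c {}" "card C = m" by blast
  then show "G \<cong>\<^sub>G star m"
    using triangle_star_isomorphic[OF _ triangle_star_star[OF assms(2)], of G C c "{}"] by simp
qed

lemma iso_copies_star_iff:
  assumes "simple_graph G" "m \<ge> 1"
  shows "G \<cong>\<^sub>G (copies a (complete_graph 3) \<union>\<^sub>G star m) \<longleftrightarrow>
    (\<exists>C c P. triangle_star G C c P \<and> card C = m \<and> card P = a)"
proof -
  obtain D d Q where Q: "triangle_star (copies a (complete_graph 3) \<union>\<^sub>G star m) D d Q"
    "card D = m" "card Q = a"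
    using triangle_star_copies[OF assms(2)] by blast
  show ?thesis
  proof
    assume "G \<cong>\<^sub>G (copies a (complete_graph 3) \<union>\<^sub>G star m)"
    then show "\<exists>C c P. triangle_star G C c P \<and> card C = m \<and> card P = a"
      using triangle_star_iso[OF Q(1) graph_iso_sym[OF assms(1)]] Q(2,3) by simp
  next
    assume "\<exists>C c P. triangle_star G C c P \<and> card C = m \<and> card P = a"
    then obtain C c P where P: "triangle_star G C c P" "card C = card D" "card P = card Q"
      using Q(2,3) by auto
    then show "G \<cong>\<^sub>G (copies a (complete_graph 3) \<union>\<^sub>G star m)"
      by (rule triangle_star_isomorphic[OF _ Q(1)])
  qed
qed

section \<open>Spanning trees of components\<close>

text \<open>A spanning tree of \<open>C\<close> rooted at \<open>u\<close>, given by parents and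
  depths; \<open>E\<close> may contain further edges. Since depths drop by one towards the parent,
  following parents never cycles.\<close>

locale parent_levels =
  fixes E :: "'a set set" and C :: "'a set" and u :: 'a and l :: "'a \<Rightarrow> nat" and p :: "'a \<Rightarrow> 'a"
  assumes finite_C: "finite C" and finite_E: "finite E" and root: "u \<in> C" "l u = 0"
    and parent: "v \<in> C \<Longrightarrow> v \<noteq> u \<Longrightarrow> p v \<in> C" "v \<in> C \<Longrightarrow> v \<noteq> u \<Longrightarrow> l v = Suc (l (p v))"
      "v \<in> C \<Longrightarrow> v \<noteq> u \<Longrightarrow> {v, p v} \<in> E"
begin

abbreviation parent_edges :: "'a set set" where
  "parent_edges \<equiv> (\<lambda>v. {v, p v}) ` (C - {u})"

text \<open>If two different vertices had the same parent edge, each would be the parent of the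
  other, and each level would exceed the other by one.\<close>

lemma inj_parent_edge: "inj_on (\<lambda>v. {v, p v}) (C - {u})"
proof (rule inj_onI)
  fix v w assume v: "v \<in> C - {u}" and w: "w \<in> C - {u}" and "{v, p v} = {w, p w}"
  then consider "v = w" | "v = p w" "w = p v" by (auto simp: doubleton_eq_iff)
  then show "v = w"
  proof cases
    case 2
    then have "l v = Suc (l w)" "l w = Suc (l v)" using parent(2)[of v] parent(2)[of w] v w by auto
    then show ?thesis by simp
  qed
qed

lemma card_parent_edges: "card parent_edges = card C - 1"
  using inj_parent_edge root finite_C by (simp add: card_image)

lemma parent_edges_subset: "parent_edges \<subseteq> E"
  using parent(3) by auto

lemma card_edges_ge: "card C - 1 \<le> card E"
  using card_mono[OF finite_E parent_edges_subset] card_parent_edges by simp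

lemma edges_eq_parent_edges: "card E = card C - 1 \<Longrightarrow> E = parent_edges"
  using card_subset_eq[OF finite_E parent_edges_subset] card_parent_edges by simp

lemma parent_edge_cases:
  assumes "{x, y} \<in> parent_edges"
  obtains "x \<in> C" "x \<noteq> u" "y = p x" "l x = Suc (l y)"
    | "y \<in> C" "y \<noteq> u" "x = p y" "l y = Suc (l x)"
proof -
  from assms obtain v where v: "v \<in> C" "v \<noteq> u" "{x, y} = {v, p v}" by auto
  then have "l v = Suc (l (p v))" by (simp add: parent(2))
  moreover have "x = v \<and> y = p v \<or> y = v \<and> x = p v" using v(3) by (auto simp: doubleton_eq_iff)
  ultimately show thesis using that v(1,2) by auto
qed

lemma parent_edge_level:
  "{x, y} \<in> parent_edges \<Longrightarrow> l x = Suc (l y) \<or> l y = Suc (l x)"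
  by (elim parent_edge_cases) simp_all

text \<open>The levels of the three vertices of a triangle would pairwise have different parity.\<close>

lemma parent_edges_triangle_free:
  assumes "{x, y} \<in> parent_edges" "{y, z} \<in> parent_edges" "{x, z} \<in> parent_edges"
  shows False
  using parent_edge_level[OF assms(1)] parent_edge_level[OF assms(2)] parent_edge_level[OF assms(3)]
  by presburger

lemma level_0: "v \<in> C \<Longrightarrow> l v = 0 \<Longrightarrow> v = u"
  using parent(2) by fastforce

text \<open>If no vertex has level 2 or more, the root is the centre. Otherwise the parent of a
  vertex of level 2 turns out to be the only vertex of level 1, and it is adjacent to everything
  else.\<close>

lemma parent_edges_star:
  assumes diam: "\<And>x y. x \<in> C \<Longrightarrow> y \<in> C \<Longrightarrow> x \<noteq> y \<Longrightarrow> {x, y} \<notin> parent_edges \<Longrightarrow>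
      \<exists>z. {x, z} \<in> parent_edges \<and> {y, z} \<in> parent_edges"
  shows "\<exists>c\<in>C. parent_edges = (\<lambda>v. {c, v}) ` (C - {c})"
proof (cases "\<exists>v\<in>C. l v \<ge> 2")
  case False
  have "p v = u" if "v \<in> C" "v \<noteq> u" for v
  proof -
    have "l v < 2" using False that(1) by auto
    then have "l (p v) = 0" using parent(2)[OF that] by simp
    then show ?thesis using level_0 parent(1)[OF that] by simp
  qed
  then have "parent_edges = (\<lambda>v. {u, v}) ` (C - {u})"
    by (intro image_cong) (auto simp: insert_commute)
  then show ?thesis using root(1) by blast
next
  case True
  \<comment> \<open>Every vertex is within two edges of the root, and each edge changes the level by
    one.\<close>
  have le2: "l w \<le> 2" if w: "w \<in> C" for w
  proof (cases "u = w \<or> {u, w} \<in> parent_edges")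
    case True
    then show ?thesis
    proof
      assume "{u, w} \<in> parent_edges"
      then show ?thesis using root(2) by (cases rule: parent_edge_cases) simp_all
    qed (use root(2) in simp)
  next
    case False
    then obtain z where "{u, z} \<in> parent_edges" "{w, z} \<in> parent_edges"
      using diam[OF root(1) w] by auto
    then show ?thesis using parent_edge_level[of u z] parent_edge_level[of w z] root(2) by auto
  qed
  obtain v where v: "v \<in> C" "l v = 2" using True le2 by (metis le_antisym)
  then have vu: "v \<noteq> u" using root by auto
  let ?c = "p v"
  have c: "?c \<in> C" "l ?c = 1" using parent(1,2)[OF v(1) vu] v(2) by auto
  then have cu: "?c \<noteq> u" using root by auto
  then have pc: "p ?c = u" using level_0 parent(1,2)[OF c(1) cu] c(2) by simp
  have only: "w = ?c" if w: "w \<in> C" "l w = 1" for w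
  proof (rule ccontr)
    assume ne: "w \<noteq> ?c"
    have "{w, v} \<notin> parent_edges"
    proof
      assume "{w, v} \<in> parent_edges"
      then show False by (cases rule: parent_edge_cases) (use w v ne in auto)
    qed
    moreover have "w \<noteq> v" using w v by auto
    ultimately obtain z where z: "{w, z} \<in> parent_edges" "{v, z} \<in> parent_edges"
      using diam[OF w(1) v(1)] by auto
    \<comment> \<open>A neighbour of \<open>v\<close> other than its parent would be a child of
      level 3.\<close>
    have "z = ?c"
      using z(2)
    proof (cases rule: parent_edge_cases)
      case 2
      then show ?thesis using le2[of z] v(2) by auto
    qed
    \<comment> \<open>Both ends of this edge have level 1.\<close>
    then show False using parent_edge_level[OF z(1)] w(2) c(2) by simp
  qed
  have par: "p w = ?c" if w: "w \<in> C" "w \<noteq> u" "w \<noteq> ?c" for w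
  proof -
    have "l w \<noteq> 0" "l w \<noteq> 1" using w level_0 only by auto
    then have "l w = 2" using le2[OF w(1)] by simp
    then show ?thesis using only[of "p w"] parent(1,2)[OF w(1,2)] by simp
  qed
  \<comment> \<open>The root is now a leaf: its edge to \<open>?c\<close> is the parent edge of
    \<open>?c\<close>. Every other leaf contributes its own parent edge.\<close>
  have "parent_edges = (\<lambda>v. {?c, v}) ` (C - {?c})"
  proof (intro equalityI subsetI)
    fix e assume "e \<in> parent_edges"
    then obtain w where w: "w \<in> C" "w \<noteq> u" "e = {w, p w}" by auto
    show "e \<in> (\<lambda>v. {?c, v}) ` (C - {?c})"
    proof (cases "w = ?c")
      case True
      then have "e = {?c, u}" using w pc by simp
      then show ?thesis using root(1) cu by auto
    next
      case False
      then have "e = {?c, w}" using w par by auto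
      then show ?thesis using w False by auto
    qed
  next
    fix e assume "e \<in> (\<lambda>v. {?c, v}) ` (C - {?c})"
    then obtain w where w: "w \<in> C" "w \<noteq> ?c" "e = {?c, w}" by auto
    show "e \<in> parent_edges"
    proof (cases "w = u")
      case True
      then have "e = {?c, p ?c}" using w pc by simp
      then show ?thesis using c cu by auto
    next
      case False
      then have "e = {w, p w}" using w par by auto
      then show ?thesis using w False by auto
    qed
  qed
  then show ?thesis using c by blast
qed

end

section \<open>Components, degree counts and disjoint triangles\<close>

definition component :: "'a graph \<Rightarrow> 'a \<Rightarrow> 'a set" where
  "component G u = {v. (u, v) \<in> {(x, y). x \<in> nbrs G y}\<^sup>*}"

lemma component_refl: "u \<in> component G u"
  by (simp add: component_def)

lemma component_closed: "v \<in> component G u \<Longrightarrow> w \<in> nbrs G v \<Longrightarrow> w \<in> component G u"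
  by (auto simp: component_def nbrs_sym intro: rtrancl_into_rtrancl)

lemma component_subset:
  assumes "simple_graph G" "u \<in> verts G"
  shows "component G u \<subseteq> verts G"
proof
  fix v assume "v \<in> component G u"
  then have "(u, v) \<in> {(x, y). x \<in> nbrs G y}\<^sup>*" by (simp add: component_def)
  then show "v \<in> verts G"
  proof (induction rule: rtrancl_induct)
    case (step y z)
    then have "z \<in> nbrs G y" by (simp add: nbrs_sym)
    then show ?case using nbrs_subset[OF assms(1)] by auto
  qed (rule assms(2))
qed

text \<open>A breadth-first tree: the level is the distance from \<open>u\<close>, and the parent is
  a neighbour one step closer.\<close>

lemma component_parent_levels:
  assumes G: "simple_graph G" and u: "u \<in> verts G"
  shows "\<exists>l p. parent_levels {e \<in> edges G. e \<subseteq> component G u} (component G u) u l p"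
proof -
  define R where "R = {(x, y). x \<in> nbrs G y}"
  define l where "l v = (LEAST k. (u, v) \<in> R ^^ k)" for v
  let ?C = "component G u"
  have lev: "(u, v) \<in> R ^^ l v" if "v \<in> ?C" for v
  proof -
    have "\<exists>k. (u, v) \<in> R ^^ k" using that by (simp add: component_def R_def rtrancl_power)
    then show ?thesis unfolding l_def by (rule LeastI_ex)
  qed
  have least: "l v \<le> k" if "(u, v) \<in> R ^^ k" for v k
    unfolding l_def using that by (rule Least_le)
  have l0: "l u = 0" using least[of u 0] by simp
  have "\<exists>w. w \<in> ?C \<and> l v = Suc (l w) \<and> {v, w} \<in> edges G" if v: "v \<in> ?C" "v \<noteq> u" for v
  proof -
    have "l v \<noteq> 0" using lev[OF v(1)] v(2) by (intro notI) simp
    then obtain k where k: "l v = Suc k" using not0_implies_Suc by blast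
    then have "(u, v) \<in> R ^^ k O R" using lev[OF v(1)] by simp
    then obtain w where w: "(u, w) \<in> R ^^ k" "(w, v) \<in> R" by blast
    then have wC: "w \<in> ?C" by (auto simp: component_def R_def rtrancl_power)
    \<comment> \<open>For the last vertex \<open>w\<close> before \<open>v\<close> on a shortest
      walk, this bound together with \<open>l w \<le> k\<close> forces
      \<open>l w = k\<close>.\<close>
    have "(u, v) \<in> R ^^ Suc (l w)" using lev[OF wC] w(2) by auto
    then have "l v \<le> Suc (l w)" by (rule least)
    moreover have "l w \<le> k" using w(1) by (rule least)
    moreover have "{v, w} \<in> edges G" using w(2) by (simp add: R_def nbrs_def insert_commute)
    ultimately show ?thesis using wC k by (intro exI[of _ w]) simp
  qed
  then obtain p where p: "\<And>v. v \<in> ?C \<Longrightarrow> v \<noteq> u \<Longrightarrow>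
      p v \<in> ?C \<and> l v = Suc (l (p v)) \<and> {v, p v} \<in> edges G"
    by metis
  have "finite ?C" using component_subset[OF G u] G by (auto simp: simple_graph_def intro: finite_subset)
  then have "parent_levels {e \<in> edges G. e \<subseteq> ?C} ?C u l p"
    using p l0 by unfold_locales (auto simp: component_refl)
  then show ?thesis by blast
qed

text \<open>The handshake identity, by double counting incidences; the neighbours of
  \<open>v\<close> correspond to the edges through \<open>v\<close>.\<close>

lemma degree_sum:
  assumes "finite E" "finite W" "\<And>e. e \<in> E \<Longrightarrow> e \<subseteq> W \<and> card e = 2"
  shows "(\<Sum>v\<in>W. card {u. {u, v} \<in> E}) = 2 * card E"
proof -
  have "card {u. {u, v} \<in> E} = card {e\<in>E. v \<in> e}" for v
  proof (rule bij_betw_same_card)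
    have "{e\<in>E. v \<in> e} = (\<lambda>u. {u, v}) ` {u. {u, v} \<in> E}"
    proof (intro equalityI subsetI)
      fix e assume e: "e \<in> {e\<in>E. v \<in> e}"
      then have "card e = 2" using assms(3) by simp
      then obtain x y where "e = {x, y}" by (auto simp: card_2_iff)
      then have "e = {x, v} \<or> e = {y, v}" using e by auto
      then show "e \<in> (\<lambda>u. {u, v}) ` {u. {u, v} \<in> E}" using e by auto
    qed auto
    then show "bij_betw (\<lambda>u. {u, v}) {u. {u, v} \<in> E} {e\<in>E. v \<in> e}"
      by (auto simp: bij_betw_def inj_on_def doubleton_eq_iff)
  qed
  moreover have "(\<Sum>v\<in>W. card {e\<in>E. v \<in> e}) = (\<Sum>e\<in>E. card e)"
  proof (rule sum_multicount_gen[OF assms(2,1)], rule ballI)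
    fix e assume "e \<in> E"
    then have "{v\<in>W. v \<in> e} = e" using assms(3) by auto
    then show "card {v\<in>W. v \<in> e} = card e" by simp
  qed
  moreover have "(\<Sum>e\<in>E. card e) = (\<Sum>e\<in>E. 2)" by (rule sum.cong) (use assms(3) in auto)
  ultimately show ?thesis by simp
qed

text \<open>As \<open>W\<close> is closed under adjacency, degrees in \<open>G\<close> agree with
  degrees among the edges inside \<open>W\<close>, so the handshake identity applies there.\<close>

lemma card_edges_regular_part:
  assumes G: "simple_graph G" and W: "W \<subseteq> verts G" "\<And>v. v \<in> W \<Longrightarrow> nbrs G v \<subseteq> W"
    and deg: "\<And>v. v \<in> W \<Longrightarrow> card (nbrs G v) = d"
  shows "2 * card {e \<in> edges G. e \<subseteq> W} = d * card W"
proof -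
  let ?E = "{e \<in> edges G. e \<subseteq> W}"
  have fin: "finite W" using G W(1) by (auto simp: simple_graph_def intro: finite_subset)
  have "card {u. {u, v} \<in> ?E} = d" if "v \<in> W" for v
  proof -
    have "{u. {u, v} \<in> ?E} = nbrs G v" using W(2)[OF that] that by (auto simp: nbrs_def)
    then show ?thesis using deg[OF that] by simp
  qed
  then have "(\<Sum>v\<in>W. card {u. {u, v} \<in> ?E}) = d * card W" by simp
  moreover have "finite ?E" using finite_subset[of ?E "Pow W"] fin by auto
  ultimately show ?thesis
    using degree_sum[OF \<open>finite ?E\<close> fin] G by (simp add: simple_graph_def)
qed

text \<open>A vertex of degree 2 on a triangle has no neighbours outside that triangle. The blocks
  are therefore the closed neighbourhoods \<open>?N v\<close>.\<close>

lemma triangle_blocks: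
  assumes G: "simple_graph G" and W: "W \<subseteq> verts G" "\<And>v. v \<in> W \<Longrightarrow> nbrs G v \<subseteq> W"
    and deg: "\<And>v. v \<in> W \<Longrightarrow> card (nbrs G v) = 2"
    and tri: "\<And>v. v \<in> W \<Longrightarrow> \<exists>x y. x \<in> nbrs G v \<and> y \<in> nbrs G v \<and> x \<in> nbrs G y"
  shows "\<exists>P. finite P \<and> (\<forall>B\<in>P. card B = 3) \<and> (\<forall>A\<in>P. \<forall>B\<in>P. A \<noteq> B \<longrightarrow> A \<inter> B = {}) \<and>
    \<Union>P = W \<and> {e \<in> edges G. e \<subseteq> W} = (\<Union>B\<in>P. {e. e \<subseteq> B \<and> card e = 2})"
proof -
  let ?N = "\<lambda>v. insert v (nbrs G v)"
  have two: "nbrs G v = {x, y}" if "v \<in> W" "x \<in> nbrs G v" "y \<in> nbrs G v" "x \<noteq> y" for v x y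
    using card_subset_eq[OF finite_nbrs[OF G], of "{x, y}" v] that deg[OF that(1)] by simp
  have N: "\<exists>x y. x \<noteq> y \<and> x \<noteq> v \<and> y \<noteq> v \<and> ?N v = {v, x, y} \<and> nbrs G x = {v, y} \<and> nbrs G y = {v, x}"
    if v: "v \<in> W" for v
  proof -
    obtain x y where xy: "x \<in> nbrs G v" "y \<in> nbrs G v" "x \<in> nbrs G y" using tri[OF v] by blast
    then have ne: "x \<noteq> y" "x \<noteq> v" "y \<noteq> v" using nbrs_irrefl[OF G] by auto
    have xyW: "x \<in> W" "y \<in> W" using W(2)[OF v] xy by auto
    have "nbrs G v = {x, y}" using two[OF v xy(1,2) ne(1)] .
    moreover have "nbrs G x = {v, y}"
      using two[OF xyW(1), of v y] xy ne nbrs_sym[of v G x] nbrs_sym[of y G x] by auto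
    moreover have "nbrs G y = {v, x}"
      using two[OF xyW(2), of v x] xy ne nbrs_sym[of v G y] by auto
    ultimately show ?thesis using ne by auto
  qed
  \<comment> \<open>All members of a block have the same closed neighbourhood; this gives both
    disjointness and completeness of the blocks.\<close>
  have same: "?N w = ?N v" if v: "v \<in> W" and w: "w \<in> ?N v" for v w
  proof -
    obtain x y where "?N v = {v, x, y}" "nbrs G x = {v, y}" "nbrs G y = {v, x}"
      using N[OF v] by auto
    then show ?thesis using w by auto
  qed
  have card3: "card (?N v) = 3" if v: "v \<in> W" for v
    using deg[OF v] nbrs_irrefl[OF G] finite_nbrs[OF G] by simp
  have clique: "{e. e \<subseteq> ?N v \<and> card e = 2} \<subseteq> {e \<in> edges G. e \<subseteq> W}" if v: "v \<in> W" for v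
  proof
    fix e assume e: "e \<in> {e. e \<subseteq> ?N v \<and> card e = 2}"
    then obtain a b where ab: "e = {a, b}" "a \<noteq> b" by (auto simp: card_2_iff)
    then have "a \<in> ?N v" "b \<in> ?N v" using e by auto
    then have "b \<in> ?N a" using same[OF v] by metis
    then have "{a, b} \<in> edges G" using ab(2) by (auto simp: nbrs_def insert_commute)
    then show "e \<in> {e \<in> edges G. e \<subseteq> W}" using e ab W(2)[OF v] v by auto
  qed
  have cover: "e \<in> (\<Union>B\<in>?N ` W. {e. e \<subseteq> B \<and> card e = 2})" if e: "e \<in> edges G" "e \<subseteq> W" for e
  proof -
    have "card e = 2" using e G by (simp add: simple_graph_def)
    then obtain a b where ab: "e = {a, b}" by (auto simp: card_2_iff)
    then have "a \<in> nbrs G b" using e by (simp add: nbrs_def)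
    then have "e \<subseteq> ?N b" "b \<in> W" using ab e by auto
    then show ?thesis using \<open>card e = 2\<close> by blast
  qed
  have fin: "finite W" using G W(1) by (auto simp: simple_graph_def intro: finite_subset)
  show ?thesis
  proof (intro exI[of _ "?N ` W"] conjI)
    show "finite (?N ` W)" using fin by simp
    show "\<forall>B\<in>?N ` W. card B = 3" using card3 by blast
    show "\<forall>A\<in>?N ` W. \<forall>B\<in>?N ` W. A \<noteq> B \<longrightarrow> A \<inter> B = {}"
    proof (intro ballI impI equals0I)
      fix A B z assume "A \<in> ?N ` W" "B \<in> ?N ` W" "A \<noteq> B" "z \<in> A \<inter> B"
      then obtain v w where vw: "v \<in> W" "w \<in> W" "A = ?N v" "B = ?N w" "z \<in> ?N v" "z \<in> ?N w"
        by blast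
      then show False using same[of v z] same[of w z] \<open>A \<noteq> B\<close> by simp
    qed
    show "\<Union>(?N ` W) = W" using W(2) by blast
    show "{e \<in> edges G. e \<subseteq> W} = (\<Union>B\<in>?N ` W. {e. e \<subseteq> B \<and> card e = 2})"
      using clique cover by blast
  qed
qed

section \<open>Structure of saturated graphs\<close>

text \<open>Such a vertex is one neighbour short of being an apex, so any new edge at it creates a
  forbidden copy.\<close>

definition full_triangle_vertex :: "nat \<Rightarrow> 'a graph \<Rightarrow> 'a \<Rightarrow> bool" where
  "full_triangle_vertex q G v \<longleftrightarrow> card (nbrs G v) = q + 1 \<and>
     (\<exists>x y. x \<in> nbrs G v \<and> y \<in> nbrs G v \<and> x \<in> nbrs G y)"

text \<open>The new triangle either uses the edge \<open>{u, v}\<close>, or is a triangle of \<open>G\<close> at \<open>u\<close> or \<open>v\<close>,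
  whose degree was one too small.\<close>

lemma saturated_nonadjacent_cases:
  assumes G: "simple_graph G" and sat: "saturated (forbidden q) G"
    and uv: "u \<in> verts G" "v \<in> verts G" "u \<noteq> v" "u \<notin> nbrs G v"
  shows "full_triangle_vertex q G u \<or> full_triangle_vertex q G v \<or>
    (\<exists>w z. q + 2 \<le> card (nbrs (add_edge G {u, v}) w) \<and> z \<in> nbrs G u \<and> z \<in> nbrs G v \<and>
      w \<in> {u, v, z})"
proof -
  let ?G = "add_edge G {u, v}"
  have no: "card (nbrs G w) < q + 2"
    if "x \<in> nbrs G w" "y \<in> nbrs G w" "x \<in> nbrs G y" for w x y
    using sat that unfolding saturated_def contains_forbidden_iff[OF G] by (meson not_le)
  obtain w x y where wxy: "x \<in> nbrs ?G w" "y \<in> nbrs ?G w" "x \<in> nbrs ?G y"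
    and deg: "q + 2 \<le> card (nbrs ?G w)"
    using sat uv contains_forbidden_iff[OF simple_graph_add_edge[OF G uv(1-3)]]
    unfolding saturated_iff_nonadjacent[OF G] by blast
  have ne: "x \<noteq> w" "y \<noteq> w" "x \<noteq> y"
    using wxy nbrs_irrefl[OF simple_graph_add_edge[OF G uv(1-3)]] by auto
  have step: "a \<in> nbrs G b \<or> {a, b} = {u, v}" if "a \<in> nbrs ?G b" for a b
    using that by (auto simp: nbrs_def add_edge_def)
  have third: "c \<in> nbrs G a \<and> c \<in> nbrs G b"
    if "c \<in> nbrs ?G a" "c \<in> nbrs ?G b" "{a, b} = {u, v}" "c \<noteq> a" "c \<noteq> b" for a b c
    using step[OF that(1)] step[OF that(2)] that(3-5) by (auto simp: doubleton_eq_iff)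
  \<comment> \<open>Either the new edge is one side of the triangle, and the opposite vertex is a
    common neighbour of \<open>u\<close> and \<open>v\<close>, or the whole triangle lies in
    \<open>G\<close>.\<close>
  consider (w) "{x, y} = {u, v}" | (x) "{y, w} = {u, v}" | (y) "{x, w} = {u, v}"
    | (old) "x \<in> nbrs G w" "y \<in> nbrs G w" "x \<in> nbrs G y"
    using step[OF wxy(1)] step[OF wxy(2)] step[OF wxy(3)] by metis
  then show ?thesis
  proof cases
    case w
    then have "w \<in> nbrs G x \<and> w \<in> nbrs G y"
      using third[of w x y] wxy ne nbrs_sym[of w ?G] by auto
    then have "w \<in> nbrs G u \<and> w \<in> nbrs G v" using w by (auto simp: doubleton_eq_iff)
    then show ?thesis using deg by blast
  next
    case x
    then have "x \<in> nbrs G y \<and> x \<in> nbrs G w"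
      using third[of x y w] wxy ne by auto
    then have "x \<in> nbrs G u \<and> x \<in> nbrs G v" "w \<in> {u, v, x}"
      using x by (auto simp: doubleton_eq_iff)
    then show ?thesis using deg by blast
  next
    case y
    then have "y \<in> nbrs G x \<and> y \<in> nbrs G w"
      using third[of y x w] wxy ne nbrs_sym[of y ?G x] by auto
    then have "y \<in> nbrs G u \<and> y \<in> nbrs G v" "w \<in> {u, v, y}"
      using y by (auto simp: doubleton_eq_iff)
    then show ?thesis using deg by blast
  next
    case old
    \<comment> \<open>In \<open>G\<close> the degree is too small for an apex, after adding the edge
      it is large enough. So \<open>w\<close> is an end of the new edge and had degree exactly
      \<open>q + 1\<close>.\<close>
    have small: "card (nbrs G w) < q + 2" by (rule no[OF old])
    have "w = u \<or> w = v"
    proof (rule ccontr)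
      assume "\<not> (w = u \<or> w = v)"
      then have "nbrs ?G w = nbrs G w" by (simp add: nbrs_add_edge)
      then show False using deg small by simp
    qed
    moreover have "card (nbrs ?G w) \<le> Suc (card (nbrs G w))"
    proof -
      have "nbrs ?G w \<subseteq> insert (if w = u then v else u) (nbrs G w)"
        using uv(3) by (auto simp: nbrs_add_edge)
      then have "card (nbrs ?G w) \<le> card (insert (if w = u then v else u) (nbrs G w))"
        by (rule card_mono[rotated]) (simp add: finite_nbrs[OF G])
      also have "\<dots> \<le> Suc (card (nbrs G w))" by (rule card_insert_le_m1[THEN order_trans]) auto
      finally show ?thesis .
    qed
    ultimately have "full_triangle_vertex q G w"
      using deg small old unfolding full_triangle_vertex_def by auto
    then show ?thesis using \<open>w = u \<or> w = v\<close> by blast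
  qed
qed

text \<open>Vertices in different components are non-adjacent and have no common neighbour, so one
  of the two is full, and \<open>u\<close> is not.\<close>

lemma full_outside_component:
  assumes G: "simple_graph G" and sat: "saturated (forbidden q) G"
    and u: "u \<in> verts G" "\<not> full_triangle_vertex q G u" and v: "v \<in> verts G - component G u"
  shows "full_triangle_vertex q G v"
proof -
  have v': "v \<noteq> u" "\<And>w. w \<in> component G u \<Longrightarrow> w \<notin> nbrs G v"
    using v component_refl[of u G] component_closed[of _ G u v] by (auto simp: nbrs_sym[of v])
  then have "u \<notin> nbrs G v" "\<And>z. z \<in> nbrs G u \<Longrightarrow> z \<notin> nbrs G v"
    using component_refl[of u G] component_closed[of u G u] by auto
  then show ?thesis
    using saturated_nonadjacent_cases[OF G sat u(1), of v] u(2) v v'(1) by blast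
qed

lemma edges_split_component:
  assumes G: "simple_graph G"
  shows "edges G = {e \<in> edges G. e \<subseteq> component G u} \<union> {e \<in> edges G. e \<subseteq> verts G - component G u}"
proof -
  have "e \<subseteq> component G u \<or> e \<subseteq> verts G - component G u" if e: "e \<in> edges G" for e
  proof -
    have "card e = 2" "e \<subseteq> verts G" using e G by (auto simp: simple_graph_def)
    then obtain a b where ab: "e = {a, b}" by (auto simp: card_2_iff)
    then have "a \<in> nbrs G b" using e by (simp add: nbrs_def)
    then have "a \<in> component G u \<longleftrightarrow> b \<in> component G u"
      using component_closed[of a G u b] component_closed[of b G u a] nbrs_sym[of a G b] by blast
    then show ?thesis using \<open>e \<subseteq> verts G\<close> ab by auto
  qed
  then show ?thesis by blast
qed

lemma finite_edges: "simple_graph G \<Longrightarrow> finite (edges G)"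
  by (rule finite_subset[of _ "Pow (verts G)"]) (auto simp: simple_graph_def)

text \<open>All degrees equal \<open>q + 1\<close>, which is at least 2; the handshake identity does
  the rest.\<close>

lemma card_edges_all_full:
  assumes G: "simple_graph G" and "q \<ge> 1" and full: "\<And>v. v \<in> verts G \<Longrightarrow> full_triangle_vertex q G v"
  shows "card (verts G) \<le> card (edges G)"
proof -
  have "2 * card (verts G) \<le> (q + 1) * card (verts G)"
    using \<open>q \<ge> 1\<close> by (intro mult_right_mono) auto
  also have "\<dots> = 2 * card {e \<in> edges G. e \<subseteq> verts G}"
    using full nbrs_subset[OF G]
    by (intro card_edges_regular_part[OF G, symmetric]) (auto simp: full_triangle_vertex_def)
  also have "{e \<in> edges G. e \<subseteq> verts G} = edges G" using G by (auto simp: simple_graph_def)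
  finally show ?thesis by simp
qed

text \<open>Fixes a vertex that is not full, so that the graph splits into its component
  \<open>C\<close> and a regular remainder \<open>W\<close> consisting of full vertices.\<close>

locale deficient_vertex =
  fixes G :: "'a graph" and q :: nat and u :: 'a
  assumes G: "simple_graph G" and q: "q \<ge> 1" and sat: "saturated (forbidden q) G"
    and u: "u \<in> verts G" "\<not> full_triangle_vertex q G u"
begin

abbreviation (input) "C \<equiv> component G u"
abbreviation (input) "W \<equiv> verts G - component G u"
abbreviation (input) "inner \<equiv> {e \<in> edges G. e \<subseteq> C}"
abbreviation (input) "outer \<equiv> {e \<in> edges G. e \<subseteq> W}"

lemma finite_verts: "finite (verts G)"
  using G by (simp add: simple_graph_def)

lemma outer_closed: "v \<in> W \<Longrightarrow> nbrs G v \<subseteq> W"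
  using nbrs_subset[OF G] component_closed[of _ G u v] by (auto simp: nbrs_sym[of v])

lemma outer_full: "v \<in> W \<Longrightarrow> full_triangle_vertex q G v"
  by (rule full_outside_component[OF G sat u])

lemma card_outer: "2 * card outer = (q + 1) * card W"
  using outer_closed outer_full
  by (intro card_edges_regular_part[OF G]) (auto simp: full_triangle_vertex_def)

lemma card_edges_split: "card (edges G) = card inner + card outer"
proof -
  have "inner \<inter> outer = {}"
  proof (rule equals0I)
    fix e assume "e \<in> inner \<inter> outer"
    then have "e = {}" "card e = 2" using G by (auto simp: simple_graph_def)
    then show False by simp
  qed
  then have "card (inner \<union> outer) = card inner + card outer"
    using finite_edges[OF G] by (intro card_Un_disjoint) auto
  then show ?thesis using edges_split_component[OF G, of u] by simp
qed

lemma card_verts_split: "card (verts G) = card C + card W" "card C \<ge> 1"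
proof -
  have sub: "C \<subseteq> verts G" by (rule component_subset[OF G u(1)])
  then have fin: "finite C" using finite_verts finite_subset by blast
  then show "card (verts G) = card C + card W"
    using sub finite_verts card_mono[OF finite_verts sub] by (simp add: card_Diff_subset)
  have "card C \<noteq> 0" using fin component_refl[of u G] by auto
  then show "card C \<ge> 1" by simp
qed

lemma card_outer_ge: "card W \<le> card outer"
proof -
  have "2 * card W \<le> (q + 1) * card W" using q by (intro mult_right_mono) auto
  also have "\<dots> = 2 * card outer" by (rule card_outer[symmetric])
  finally show ?thesis by simp
qed

lemma card_inner_ge: "card C - 1 \<le> card inner"
proof -
  obtain l p where "parent_levels inner C u l p"
    using component_parent_levels[OF G u(1)] by blast
  then show ?thesis by (rule parent_levels.card_edges_ge)
qed

lemma card_edges_ge: "card (verts G) - 1 \<le> card (edges G)"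
  using card_edges_split card_verts_split card_outer_ge card_inner_ge by simp

text \<open>Tightness turns both estimates into equalities: the edges inside \<open>C\<close> form a
  tree and \<open>W\<close> carries exactly \<open>card W\<close> edges.\<close>

lemma extremal_structure:
  assumes tight: "card (edges G) = card (verts G) - 1"
  shows "\<exists>c P. triangle_star G C c P \<and> (q = 1 \<and> card C \<noteq> 3 \<or> P = {})"
proof -
  have inner: "card inner = card C - 1" and outer: "card outer = card W"
    using tight card_edges_split card_verts_split card_outer_ge card_inner_ge by simp_all
  have VC: "C \<subseteq> verts G" by (rule component_subset[OF G u(1)])
  obtain l p where "parent_levels inner C u l p"
    using component_parent_levels[OF G u(1)] by blast
  then interpret T: parent_levels inner C u l p .
  have T: "inner = T.parent_edges" by (rule T.edges_eq_parent_edges[OF inner])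
  have edge: "x \<in> nbrs G y \<longleftrightarrow> {x, y} \<in> T.parent_edges" if "y \<in> C" for x y
    using that component_closed[of y G u x] unfolding T[symmetric] by (auto simp: nbrs_def)
  \<comment> \<open>A tree has no triangles. Hence every non-adjacent pair in \<open>C\<close> falls
    under the remaining alternative and has a common neighbour, which makes the tree a star.\<close>
  have nofull: "\<not> full_triangle_vertex q G v" if v: "v \<in> C" for v
  proof
    assume "full_triangle_vertex q G v"
    then obtain x y where xy: "x \<in> nbrs G v" "y \<in> nbrs G v" "x \<in> nbrs G y"
      by (auto simp: full_triangle_vertex_def)
    have "y \<in> C" by (rule component_closed[OF v xy(2)])
    then show False
      using T.parent_edges_triangle_free[of x y v] edge xy v by auto
  qed
  have common: "\<exists>w z. q + 2 \<le> card (nbrs (add_edge G {x, y}) w) \<and> z \<in> nbrs G x \<and> z \<in> nbrs G y \<and>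
      w \<in> {x, y, z}" if "x \<in> C" "y \<in> C" "x \<noteq> y" "x \<notin> nbrs G y" for x y
    using saturated_nonadjacent_cases[OF G sat, of x y] nofull that VC by blast
  have "\<exists>c\<in>C. T.parent_edges = (\<lambda>v. {c, v}) ` (C - {c})"
  proof (rule T.parent_edges_star)
    fix x y assume xy: "x \<in> C" "y \<in> C" "x \<noteq> y" "{x, y} \<notin> T.parent_edges"
    then have "x \<notin> nbrs G y" using edge by simp
    then obtain z where "z \<in> nbrs G x" "z \<in> nbrs G y" using common[OF xy(1-3)] by blast
    then have "{z, x} \<in> T.parent_edges" "{z, y} \<in> T.parent_edges" using edge xy by auto
    then show "\<exists>z. {x, z} \<in> T.parent_edges \<and> {y, z} \<in> T.parent_edges"
      by (intro exI[of _ z]) (simp add: insert_commute)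
  qed
  then obtain c where c: "c \<in> C" and star: "inner = (\<lambda>v. {c, v}) ` (C - {c})"
    using T by auto
  have fin: "finite C" "finite W" using VC finite_verts finite_subset by auto
  have blocks: "\<exists>P. finite P \<and> (\<forall>B\<in>P. card B = 3) \<and> (\<forall>A\<in>P. \<forall>B\<in>P. A \<noteq> B \<longrightarrow> A \<inter> B = {}) \<and>
    \<Union>P = W \<and> outer = (\<Union>B\<in>P. {e. e \<subseteq> B \<and> card e = 2})" if "q = 1 \<or> W = {}"
    using that
  proof
    assume "q = 1"
    then show ?thesis
      using outer_full outer_closed
      by (intro triangle_blocks[OF G]) (auto simp: full_triangle_vertex_def)
  next
    assume W: "W = {}"
    have "card outer = 0" using outer by (simp only: W card.empty)
    moreover have "finite outer" using finite_edges[OF G] by simp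
    ultimately have "outer = {}" by (simp only: card_0_eq)
    then show ?thesis unfolding \<open>outer = {}\<close> unfolding W by (intro exI[of _ "{}"]) simp
  qed
  \<comment> \<open>The remainder has \<open>(q + 1) * card W\<close> edge ends but only
    \<open>card W\<close> edges.\<close>
  have "q = 1 \<or> W = {}"
  proof (rule ccontr)
    assume "\<not> (q = 1 \<or> W = {})"
    then have "q + 1 > 2" "card W > 0" using q fin(2) by (auto simp: card_gt_0_iff)
    then have "2 * card W < (q + 1) * card W" by simp
    then show False using card_outer outer by simp
  qed
  from blocks[OF this] obtain P where P: "finite P" "\<forall>B\<in>P. card B = 3" "\<forall>A\<in>P. \<forall>B\<in>P. A \<noteq> B \<longrightarrow> A \<inter> B = {}"
    "\<Union>P = W" "outer = (\<Union>B\<in>P. {e. e \<subseteq> B \<and> card e = 2})"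
    by (elim exE conjE) (rule that)
  have ts: "triangle_star G C c P"
    unfolding triangle_star_def
  proof (intro conjI)
    show "\<forall>B\<in>P. card B = 3 \<and> B \<inter> C = {}" using P(2,4) by blast
    show "verts G = C \<union> \<Union>P" using P(4) VC by blast
    show "edges G = (\<lambda>v. {c, v}) ` (C - {c}) \<union> (\<Union>B\<in>P. {e. e \<subseteq> B \<and> card e = 2})"
      using edges_split_component[OF G, of u] star P(5) by simp
  qed (use fin c P in simp_all)
  \<comment> \<open>Joining the two leaves of a star on three vertices must produce a vertex of
    degree at least \<open>q + 2\<close> inside \<open>C\<close>, but no degree there exceeds
    2.\<close>
  have "card C \<noteq> 3"
  proof
    assume C3: "card C = 3"
    then have "card (C - {c}) = 2" using c fin by simp
    then obtain x y where xy: "C - {c} = {x, y}" "x \<noteq> y" by (auto simp: card_2_iff)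
    have sub: "x \<in> C" "y \<in> C" "y \<noteq> c" "x \<noteq> c" using xy(1) by auto
    have "nbrs G y = {c}" by (rule nbrs_triangle_star_leaf[OF ts sub(2,3)])
    then have nadj: "x \<notin> nbrs G y" using sub by simp
    obtain w z where w: "q + 2 \<le> card (nbrs (add_edge G {x, y}) w)"
      "z \<in> nbrs G x" "w \<in> {x, y, z}"
      using common[OF sub(1,2) xy(2) nadj] by blast
    have wC: "w \<in> C" using w(2,3) sub component_closed[of x G u z] by auto
    have sg: "simple_graph (add_edge G {x, y})"
      using simple_graph_add_edge[OF G _ _ xy(2)] sub VC by auto
    have "nbrs (add_edge G {x, y}) w \<subseteq> C - {w}"
      using nbrs_irrefl[OF sg, of w] component_closed[OF wC] sub
      by (auto simp: nbrs_add_edge split: if_splits)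
    then have "card (nbrs (add_edge G {x, y}) w) \<le> card (C - {w})"
      using fin by (intro card_mono) auto
    then show False using w(1) C3 wC fin q by simp
  qed
  moreover have "P = {}" if "W = {}"
  proof -
    have "B = {}" if "B \<in> P" for B using that P(4) \<open>W = {}\<close> by blast
    then show ?thesis using P(2) by fastforce
  qed
  ultimately show ?thesis using ts \<open>q = 1 \<or> W = {}\<close> by blast
qed

end

section \<open>Extremal graphs and the saturation number\<close>

lemma saturated_card_edges_ge:
  assumes "simple_graph G" "q \<ge> 1" "saturated (forbidden q) G"
  shows "card (verts G) - 1 \<le> card (edges G)"
proof (cases "\<forall>v\<in>verts G. full_triangle_vertex q G v")
  case True
  then show ?thesis using card_edges_all_full[OF assms(1,2)] by simp
next
  case False
  then show ?thesis using deficient_vertex.card_edges_ge[OF deficient_vertex.intro[OF assms]] by blast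
qed

text \<open>If all vertices were full, there would be at least as many edges as vertices,
  contradicting the edge count for a nonempty graph. For the empty graph truncated subtraction would
  hide this contradiction.\<close>

lemma saturated_extremal:
  assumes "simple_graph G" "q \<ge> 1" "saturated (forbidden q) G"
    and "card (edges G) = card (verts G) - 1" "verts G \<noteq> {}"
  shows "\<exists>C c P. triangle_star G C c P \<and> (q = 1 \<and> card C \<noteq> 3 \<or> P = {})"
proof (cases "\<forall>v\<in>verts G. full_triangle_vertex q G v")
  case True
  have "card (verts G) > 0" using assms(1,5) by (simp add: simple_graph_def card_gt_0_iff)
  then show ?thesis using card_edges_all_full[OF assms(1,2)] True assms(4) by simp
next
  case False
  then obtain u where "deficient_vertex G q u"
    using deficient_vertex.intro[OF assms(1-3)] by blast
  then show ?thesis using deficient_vertex.extremal_structure[OF _ assms(4)] by blast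
qed

lemma extremal_iff:
  assumes q: "q \<ge> 1" and n: "n \<ge> q + 3"
  shows "simple_graph G \<and> card (verts G) = n \<and> saturated (forbidden q) G \<and> card (edges G) = n - 1 \<longleftrightarrow>
    (\<exists>C c P. triangle_star G C c P \<and> card C + 3 * card P = n \<and> (q = 1 \<and> card C \<noteq> 3 \<or> P = {}))"
    (is "?L \<longleftrightarrow> ?R")
proof
  assume L: ?L
  then have "verts G \<noteq> {}" using n by auto
  then obtain C c P where P: "triangle_star G C c P" "q = 1 \<and> card C \<noteq> 3 \<or> P = {}"
    using saturated_extremal[of G q] L q by auto
  then show ?R using card_verts_triangle_star[OF P(1)] L by auto
next
  assume ?R
  then obtain C c P where P: "triangle_star G C c P" "card C + 3 * card P = n"
    "q = 1 \<and> card C \<noteq> 3 \<or> P = {}" by blast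
  have "card C \<noteq> 0" using P(1) by (auto simp: triangle_star_def)
  \<comment> \<open>Without blocks \<open>card C\<close> equals \<open>n\<close>, so the bound on
    \<open>n\<close> is the size condition on the star.\<close>
  moreover have "saturated (forbidden q) G"
    using saturated_triangle_star[OF P(1) q] P(2,3) n by auto
  ultimately show ?L
    using simple_graph_triangle_star[OF P(1)] card_verts_triangle_star[OF P(1)]
      card_edges_triangle_star[OF P(1)] P(2) by simp
qed

lemma sat_forbidden:
  assumes q: "q \<ge> 1" and n: "n \<ge> q + 3"
  shows "sat n (forbidden q) = n - 1"
  unfolding sat_def
proof (rule Least_equality)
  \<comment> \<open>The star attains the lower bound and, having vertices in \<open>nat\<close>, is
    a witness for \<open>sat\<close>.\<close>
  have "triangle_star (star n) {..<n} 0 {}" using n by (intro triangle_star_star) simp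
  then have "\<exists>C c P. triangle_star (star n) C c P \<and> card C + 3 * card P = n \<and>
      (q = 1 \<and> card C \<noteq> 3 \<or> P = {})"
    by (intro exI[of _ "{..<n}"] exI[of _ 0] exI[of _ "{}"]) simp
  then show "\<exists>G :: nat graph. simple_graph G \<and> card (verts G) = n \<and>
      saturated (forbidden q) G \<and> card (edges G) = n - 1"
    using extremal_iff[OF q n] by blast
qed (use saturated_card_edges_ge q in blast)

lemma SAT_forbidden:
  assumes q: "q \<ge> 1" and n: "n \<ge> q + 3"
  shows "G \<in> SAT n (forbidden q) \<longleftrightarrow>
    (\<exists>C c P. triangle_star G C c P \<and> card C + 3 * card P = n \<and> (q = 1 \<and> card C \<noteq> 3 \<or> P = {}))"
  using extremal_iff[OF q n, of G] by (simp add: SAT_def sat_forbidden[OF q n])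

theorem theorem1p3:
  fixes q n :: nat
  defines "F \<equiv> complete_graph 1 \<or>\<^sub>G (complete_graph 2 \<union>\<^sub>G copies q (complete_graph 1))"
  assumes "q \<ge> 1" and "n \<ge> q + 3"
  shows "sat n F = n - 1 \<and>
    (q = 1 \<longrightarrow>
      (SAT n F :: 'a graph set) =
        {G. simple_graph G \<and>
            (G \<cong>\<^sub>G star n \<or>
             (\<exists>a::nat. a \<ge> 1 \<and> n > 3 * a \<and> n - 3 * a \<noteq> 3 \<and>
                G \<cong>\<^sub>G (copies a (complete_graph 3) \<union>\<^sub>G star (n - 3 * a))))}) \<and>
    (q \<ge> 2 \<longrightarrow>
      (SAT n F :: 'a graph set) = {G. simple_graph G \<and> G \<cong>\<^sub>G star n})"
proof -
  have F: "F = forbidden q" by (simp only: F_def forbidden_def)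
  note q = \<open>q \<ge> 1\<close> and n = \<open>n \<ge> q + 3\<close>
  have n1: "n \<ge> 1" using n by simp
  have star: "simple_graph G \<and> G \<cong>\<^sub>G star n \<longleftrightarrow> (\<exists>C c. triangle_star G C c {} \<and> card C = n)"
    for G :: "'a graph"
    using iso_star_iff[OF _ n1, of G] simple_graph_triangle_star[of G _ _ "{}"] by auto
  have one: "G \<in> SAT n F \<longleftrightarrow> simple_graph G \<and>
      (G \<cong>\<^sub>G star n \<or>
       (\<exists>a::nat. a \<ge> 1 \<and> n > 3 * a \<and> n - 3 * a \<noteq> 3 \<and>
          G \<cong>\<^sub>G (copies a (complete_graph 3) \<union>\<^sub>G star (n - 3 * a))))" (is "?L \<longleftrightarrow> ?R")
    if "q = 1" for G :: "'a graph"
  proof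
    assume ?L
    then obtain C c P where P: "triangle_star G C c P" "card C + 3 * card P = n"
      "card C \<noteq> 3 \<or> P = {}"
      unfolding F SAT_forbidden[OF q n] by blast
    note G = simple_graph_triangle_star[OF P(1)]
    show ?R
    proof (cases "P = {}")
      case True
      then show ?thesis using star P by auto
    next
      case False
      have "finite P" "finite C" "c \<in> C" using P(1) by (auto simp: triangle_star_def)
      \<comment> \<open>The number of triangles is \<open>card P\<close>; the centre makes
        \<open>C\<close> nonempty, which gives the strict inequality
        \<open>n > 3 * card P\<close>.\<close>
      then have a: "card P \<ge> 1" "card C \<ge> 1" using False by (auto simp: Suc_le_eq card_gt_0_iff)
      have m: "n - 3 * card P = card C" using P(2) by simp
      have "G \<cong>\<^sub>G (copies (card P) (complete_graph 3) \<union>\<^sub>G star (card C))"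
        using iso_copies_star_iff[OF G a(2)] P(1) by blast
      then show ?thesis
        using G a m P(2,3) False by (intro conjI disjI2 exI[of _ "card P"]) auto
    qed
  next
    assume R: ?R
    then consider "G \<cong>\<^sub>G star n"
      | a where "n > 3 * a" "n - 3 * a \<noteq> 3"
        "G \<cong>\<^sub>G (copies a (complete_graph 3) \<union>\<^sub>G star (n - 3 * a))" by blast
    then show ?L
    proof cases
      case 1
      then obtain C c where "triangle_star G C c {}" "card C = n" using star R by blast
      then show ?thesis unfolding F SAT_forbidden[OF q n] by force
    next
      case 2
      then obtain C c P where "triangle_star G C c P" "card C = n - 3 * a" "card P = a"
        using iso_copies_star_iff[of G "n - 3 * a" a] R by auto
      then show ?thesis unfolding F SAT_forbidden[OF q n]
        using 2 that by (intro exI[of _ C] exI[of _ c] exI[of _ P]) simp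
    qed
  qed
  \<comment> \<open>Here only the alternative without triangles survives.\<close>
  have two: "G \<in> SAT n F \<longleftrightarrow> simple_graph G \<and> G \<cong>\<^sub>G star n" if "q \<ge> 2" for G :: "'a graph"
    unfolding F SAT_forbidden[OF q n] star using that by auto
  show ?thesis
    using sat_forbidden[OF q n] one two unfolding F by blast
qed

end
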